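(* Let $\mathcal A=\{A_i\}_{i\in\Lambda}$ be a finite collection of $SL_2(\mathbb R)$ matrices with a strictly invariant multicone $U$, let $\Phi=\{\varphi_{A_i}\}_{i\in\Lambda}$ be the induced IFS on $\mathbb{RP}^1$, and let $p=(p_i)_{i\in\Lambda}$ be a probability vector with all $p_i>0$. Then $\chi_{\Phi,p}=2\chi_{\mathcal A,p}$.
   Context: $\mathbb{RP}^1\cong[0,\pi)\cong\mathbb R/\pi\mathbb Z$; $\varphi_A$ is the induced action and derivatives are in this coordinate. A strictly invariant multicone is a proper nonempty open $U\subset\mathbb{RP}^1$ with finitely many components having disjoint closures and $\varphi_{A_i}(\overline U)\subset U$ for all $i$. Write $A_{\mathbf i}=A_{i_1}\cdots A_{i_n}$ and $\varphi_{\mathbf i}=\varphi_{A_{i_1}}\circ\cdots\circ\varphi_{A_{i_n}}$. With $i_1,i_2,\ldots$ chosen i.i.d. according to $p$: $\chi_{\mathcal A,p}$ is the almost sure value of $\lim_n\frac1n\log\|A_{i_1\cdots i_n}\|$, and, for a fixed $x_0\in U$, $\chi_{\Phi,p}$ is the almost sure value of $\lim_n-\frac1n\log|(\varphi_{i_1\cdots i_n})'(x_0)|$. *)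

theory Defs
  imports "HOL-Probability.Probability"
begin

text \<open>RP^1 is identified with R / pi Z via the angle coordinate theta in [0,pi).
  rp_norm picks the representative in [0,pi).\<close>
definition rp_norm :: "real \<Rightarrow> real" where
  "rp_norm t = t - pi * of_int \<lfloor>t / pi\<rfloor>"

text \<open>Distance on R / pi Z.\<close>
definition rp_dist :: "real \<Rightarrow> real \<Rightarrow> real" where
  "rp_dist a b = \<bar>(a - b) - pi * of_int (round ((a - b) / pi))\<bar>"

text \<open>Induced projective action of a 2x2 matrix, in the angle coordinate.\<close>
definition phi :: "real^2^2 \<Rightarrow> real \<Rightarrow> real" where
  "phi M \<theta> = (let v = M *v vector [cos \<theta>, sin \<theta>] in rp_norm (Arg (Complex (v$1) (v$2))))"

text \<open>Derivative of a self-map of R / pi Z (given by representatives) in the angle coordinate.\<close>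
definition rp_has_deriv :: "(real \<Rightarrow> real) \<Rightarrow> real \<Rightarrow> real \<Rightarrow> bool" where
  "rp_has_deriv g D x \<longleftrightarrow>
     ((\<lambda>h. rp_dist (g (x + h)) (g x + D * h) / \<bar>h\<bar>) \<longlongrightarrow> 0) (at 0)"

definition rp_deriv :: "(real \<Rightarrow> real) \<Rightarrow> real \<Rightarrow> real" where
  "rp_deriv g x = (THE D. rp_has_deriv g D x)"

text \<open>Embedding of RP^1 = R / pi Z onto the unit circle (used for its topology).\<close>
definition rp_emb :: "real \<Rightarrow> complex" where
  "rp_emb \<theta> = cis (2 * \<theta>)"

text \<open>Strictly invariant multicone U (a subset of the unit circle, i.e. of RP^1 via rp_emb).\<close>
definition strictly_invariant_multicone :: "('i \<Rightarrow> real^2^2) \<Rightarrow> complex set \<Rightarrow> bool" where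
  "strictly_invariant_multicone A U \<longleftrightarrow>
     openin (top_of_set (sphere 0 1)) U \<and> U \<noteq> {} \<and> U \<noteq> sphere 0 1 \<and>
     finite (components U) \<and>
     (\<forall>C\<in>components U. \<forall>C'\<in>components U. C \<noteq> C' \<longrightarrow> closure C \<inter> closure C' = {}) \<and>
     (\<forall>i \<theta>. rp_emb \<theta> \<in> closure U \<longrightarrow> rp_emb (phi (A i) \<theta>) \<in> U)"

text \<open>A_{i_1} ... A_{i_n} and phi_{i_1} o ... o phi_{i_n} for the word [i_1,...,i_n].\<close>
definition mat_word :: "('i \<Rightarrow> real^2^2) \<Rightarrow> 'i list \<Rightarrow> real^2^2" where
  "mat_word A is = foldr (\<lambda>i M. A i ** M) is (mat 1)"

definition phi_word :: "('i \<Rightarrow> real^2^2) \<Rightarrow> 'i list \<Rightarrow> real \<Rightarrow> real" where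
  "phi_word A is = foldr (\<lambda>i f. phi (A i) \<circ> f) is id"

end

(*
  The cone condition makes every product A_w expand the directions in the closure of U at almost
  the maximal rate: |A_w v| >= c |A_w| |v| for a constant c > 0 independent of the word w.
  Consequently ln |A_w| is subadditive and superadditive up to the constant -2 ln c, and for such
  functionals of an i.i.d. word the strong law of large numbers applied to independent blocks
  already forces ln |A_w| / n to converge almost surely. Finally, for det M = 1 the projective
  action has derivative 1 / |M (cos x, sin x)|^2 at the angle x, so -ln |(phi_w)'(x0)| stays within
  -2 ln c of 2 ln |A_w| whenever x0 lies in U.
*)

theory Submission
  imports Defs
begin

section \<open>Plane vectors and points of the projective line\<close>

text \<open>A nonzero vector v spans the point (v/|v|)^2 of the unit circle (reading v as a complex
  number); this is the point rp_emb t of RP^1 when v is a multiple of (cos t, sin t).\<close>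

definition complex_of_vec :: "real^2 \<Rightarrow> complex" where
  "complex_of_vec v = Complex (v$1) (v$2)"

definition proj_point :: "real^2 \<Rightarrow> complex" where
  "proj_point v = complex_of_vec v / cnj (complex_of_vec v)"

definition det2 :: "real^2 \<Rightarrow> real^2 \<Rightarrow> real" where
  "det2 x y = x$1 * y$2 - x$2 * y$1"

definition dir_vec :: "real \<Rightarrow> real^2" where
  "dir_vec t = vector [cos t, sin t]"

definition perp :: "real^2 \<Rightarrow> real^2" where
  "perp v = vector [- (v$2), v$1]"

definition rot :: "real \<Rightarrow> real^2 \<Rightarrow> real^2" where
  "rot t v = cos t *\<^sub>R v + sin t *\<^sub>R perp v"

lemma norm_vec2: "norm (v::real^2) = sqrt ((v$1)\<^sup>2 + (v$2)\<^sup>2)"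
  by (simp add: norm_vec_def L2_set_def sum_2)

lemma matrix_vector_mult_nth_2:
  "((M::real^2^2) *v v)$1 = M$1$1 * v$1 + M$1$2 * v$2"
  "((M::real^2^2) *v v)$2 = M$2$1 * v$1 + M$2$2 * v$2"
  by (simp_all add: matrix_vector_mult_def sum_2)

lemma perp_nth [simp]: "perp v $ 1 = - (v$2)" "perp v $ 2 = v$1"
  by (simp_all add: perp_def)

lemma norm_complex_of_vec: "cmod (complex_of_vec v) = norm v"
  by (simp add: complex_of_vec_def cmod_def norm_vec2)

lemma complex_of_vec_eq_0_iff: "complex_of_vec v = 0 \<longleftrightarrow> v = 0"
  by (auto simp: complex_of_vec_def complex_eq_iff vec_eq_iff forall_2)

lemma complex_of_vec_inj: "complex_of_vec x = complex_of_vec y \<Longrightarrow> x = y"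
  by (simp add: complex_of_vec_def complex_eq_iff vec_eq_iff forall_2)

lemma complex_of_vec_add: "complex_of_vec (x + y) = complex_of_vec x + complex_of_vec y"
  by (simp add: complex_of_vec_def complex_eq_iff)

lemma complex_of_vec_scaleR: "complex_of_vec (r *\<^sub>R v) = of_real r * complex_of_vec v"
  by (simp add: complex_of_vec_def complex_eq_iff)

lemma complex_of_vec_rot: "complex_of_vec (rot t v) = cis t * complex_of_vec v"
  by (simp add: rot_def complex_of_vec_def complex_eq_iff algebra_simps)

lemma complex_of_vec_dir_vec: "complex_of_vec (dir_vec t) = cis t"
  by (simp add: dir_vec_def complex_of_vec_def cis.ctr)

lemma bounded_linear_complex_of_vec: "bounded_linear complex_of_vec"
proof (rule bounded_linear_intro[where K=1])
  show "complex_of_vec (r *\<^sub>R x) = r *\<^sub>R complex_of_vec x" for r x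
    by (subst complex_of_vec_scaleR) (simp add: scaleR_conv_of_real)
qed (simp_all add: complex_of_vec_add norm_complex_of_vec)

lemma norm_rot: "norm (rot t v) = norm v"
  by (metis norm_complex_of_vec complex_of_vec_rot norm_cis norm_mult mult_1)

lemma norm_perp: "norm (perp v) = norm v"
  by (simp add: perp_def norm_vec2)

lemma norm_dir_vec: "norm (dir_vec t) = 1"
  using norm_complex_of_vec[of "dir_vec t"] by (simp add: complex_of_vec_dir_vec)

lemma dir_vec_nonzero: "dir_vec t \<noteq> 0"
  using norm_dir_vec[of t] by auto

lemma polar_dir_vec: "v \<noteq> 0 \<Longrightarrow> v = norm v *\<^sub>R dir_vec (Arg (complex_of_vec v))"
  by (rule complex_of_vec_inj)
    (simp add: complex_of_vec_scaleR complex_of_vec_dir_vec cis_Arg sgn_eq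
      norm_complex_of_vec[symmetric] complex_of_vec_eq_0_iff)

lemma det2_zero [simp]: "det2 0 y = 0" "det2 y 0 = 0"
  by (simp_all add: det2_def)

lemma det2_swap: "det2 x y = - det2 y x"
  by (simp add: det2_def)

lemma det2_linear_right: "det2 z (a *\<^sub>R x + b *\<^sub>R y) = a * det2 z x + b * det2 z y"
  by (simp add: det2_def algebra_simps)

lemma det2_perp: "det2 v (perp v) = (norm v)\<^sup>2"
  by (simp add: det2_def norm_vec2 power2_eq_square)

lemma det2_matrix_vector_mult: "det2 (M *v x) (M *v y) = det M * det2 x y"
  by (simp add: det2_def matrix_vector_mult_nth_2 det_2 algebra_simps)

lemma abs_det2_le: "\<bar>det2 x y\<bar> \<le> norm x * norm y"
proof -
  have "((x$1)\<^sup>2 + (x$2)\<^sup>2) * ((y$1)\<^sup>2 + (y$2)\<^sup>2) = (det2 x y)\<^sup>2 + (x$1*y$1 + x$2*y$2)\<^sup>2"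
    unfolding det2_def by (simp add: power2_eq_square algebra_simps)
  then have "(det2 x y)\<^sup>2 \<le> ((x$1)\<^sup>2 + (x$2)\<^sup>2) * ((y$1)\<^sup>2 + (y$2)\<^sup>2)"
    by simp
  then have "sqrt ((det2 x y)\<^sup>2) \<le> sqrt (((x$1)\<^sup>2 + (x$2)\<^sup>2) * ((y$1)\<^sup>2 + (y$2)\<^sup>2))"
    using real_sqrt_le_mono by blast
  then show ?thesis
    by (simp add: norm_vec2 real_sqrt_mult)
qed

lemma vec2_decomp:
  assumes "v \<noteq> 0"
  shows "x = ((x \<bullet> v) / (norm v)\<^sup>2) *\<^sub>R v + (det2 v x / (norm v)\<^sup>2) *\<^sub>R perp v"
proof -
  have n: "(norm v)\<^sup>2 = (v$1)\<^sup>2 + (v$2)\<^sup>2"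
    by (simp add: norm_vec2)
  then have "v$1 * v$1 + v$2 * v$2 \<noteq> 0"
    using assms by (metis power2_eq_square zero_eq_power2 norm_eq_zero)
  then show ?thesis
    unfolding vec_eq_iff forall_2 using n
    by (simp add: inner_vec_def sum_2 det2_def power2_eq_square divide_simps)
      (auto simp add: algebra_simps)
qed

lemma vec2_cramer: "det2 z1 z2 *\<^sub>R x = det2 x z2 *\<^sub>R z1 + det2 z1 x *\<^sub>R z2"
  by (simp add: vec_eq_iff forall_2 det2_def algebra_simps)

lemma matrix_vector_mult_nonzero:
  assumes "det M \<noteq> 0" "v \<noteq> 0"
  shows "(M::real^2^2) *v v \<noteq> 0"
proof
  assume "M *v v = 0"
  then have "det2 (M *v v) (M *v perp v) = 0"
    by simp
  then show False
    using assms by (simp add: det2_matrix_vector_mult det2_perp)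
qed

lemma matrix_vector_mult_rot:
  "(M::real^2^2) *v rot t v = cos t *\<^sub>R (M *v v) + sin t *\<^sub>R (M *v perp v)"
  by (simp add: rot_def matrix_vector_right_distrib matrix_vector_mult_scaleR)

lemma proj_point_eq_square: "proj_point v = (complex_of_vec v)\<^sup>2 / of_real ((norm v)\<^sup>2)"
proof (cases "complex_of_vec v = 0")
  case True
  then show ?thesis
    by (simp add: proj_point_def)
next
  case False
  have "complex_of_vec v * cnj (complex_of_vec v) = of_real ((norm v)\<^sup>2)"
    by (metis complex_norm_square norm_complex_of_vec)
  moreover have "complex_of_vec v / cnj (complex_of_vec v)
      = (complex_of_vec v * complex_of_vec v) / (complex_of_vec v * cnj (complex_of_vec v))"
    using False by simp
  ultimately show ?thesis
    by (simp add: proj_point_def power2_eq_square)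
qed

lemma norm_proj_point: "v \<noteq> 0 \<Longrightarrow> cmod (proj_point v) = 1"
  by (simp add: proj_point_def norm_divide complex_of_vec_eq_0_iff)

lemma proj_point_scaleR: "r \<noteq> 0 \<Longrightarrow> proj_point (r *\<^sub>R v) = proj_point v"
  by (simp add: proj_point_def complex_of_vec_scaleR)

lemma proj_point_polar:
  assumes "complex_of_vec v = of_real r * cis a" "r \<noteq> 0"
  shows "proj_point v = rp_emb a"
  using assms by (simp add: proj_point_def rp_emb_def cis_cnj cis_divide)

lemma proj_point_dir_vec: "proj_point (dir_vec t) = rp_emb t"
  using proj_point_polar[of "dir_vec t" 1 t] by (simp add: complex_of_vec_dir_vec)

lemma proj_point_rot: "proj_point (rot t v) = cis (2*t) * proj_point v"
proof -
  have "proj_point (rot t v) = (cis t / cis (-t)) * proj_point v"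
    by (simp add: proj_point_def complex_of_vec_rot cis_cnj)
  then show ?thesis
    by (simp add: cis_divide)
qed

lemma proj_point_dir_vec_Arg:
  assumes "cmod z = 1"
  shows "proj_point (dir_vec (Arg z / 2)) = z"
proof -
  have "z \<noteq> 0"
    using assms by auto
  then show ?thesis
    using assms by (simp add: proj_point_dir_vec rp_emb_def cis_Arg sgn_eq)
qed

lemma proj_point_eq_iff:
  assumes "x \<noteq> 0" "y \<noteq> 0"
  shows "proj_point x = proj_point y \<longleftrightarrow> det2 x y = 0"
proof -
  have "cnj (complex_of_vec x) \<noteq> 0" "cnj (complex_of_vec y) \<noteq> 0"
    using assms complex_of_vec_eq_0_iff by auto
  then have "proj_point x = proj_point y \<longleftrightarrow>
      complex_of_vec x * cnj (complex_of_vec y) = complex_of_vec y * cnj (complex_of_vec x)"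
    by (simp add: proj_point_def field_simps)
  also have "\<dots> \<longleftrightarrow> det2 x y = 0"
    by (auto simp: complex_of_vec_def det2_def complex_eq_iff algebra_simps)
  finally show ?thesis .
qed

lemma continuous_on_proj_point: "continuous_on {v. v \<noteq> 0} proj_point"
proof -
  have "continuous_on {v. v \<noteq> 0} complex_of_vec"
    by (rule linear_continuous_on[OF bounded_linear_complex_of_vec])
  then show ?thesis
    unfolding proj_point_def[abs_def]
    by (intro continuous_intros) (auto simp: complex_of_vec_eq_0_iff)
qed

lemma dist_cis_mult_self: "cmod z = 1 \<Longrightarrow> dist (cis a * z) z \<le> \<bar>a\<bar>"
proof -
  assume z: "cmod z = 1"
  have "(cmod (cis a - 1))\<^sup>2 = (cos a - 1)\<^sup>2 + (sin a)\<^sup>2"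
    by (simp add: cmod_power2)
  also have "\<dots> = 2 - 2 * cos (2 * (a/2))"
    by (simp add: power2_eq_square algebra_simps sin_squared_eq)
  also have "\<dots> = (2 * sin (a/2))\<^sup>2"
    by (simp only: cos_double_sin) (simp add: power2_eq_square)
  finally have "(cmod (cis a - 1))\<^sup>2 = (2 * sin (a/2))\<^sup>2" .
  then have "cmod (cis a - 1) = \<bar>2 * sin (a/2)\<bar>"
    by (metis power2_abs power2_eq_iff_nonneg abs_ge_zero norm_ge_zero abs_norm_cancel)
  also have "\<dots> \<le> \<bar>a\<bar>"
    using abs_sin_x_le_abs_x[of "a/2"] by (simp add: abs_mult)
  moreover have "cis a * z - z = (cis a - 1) * z"
    by (simp add: algebra_simps)
  ultimately show ?thesis
    using z by (simp add: dist_norm norm_mult)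
qed

lemma rp_emb_rp_norm: "rp_emb (rp_norm x) = rp_emb x"
proof -
  have "rp_emb (rp_norm x) = cis (2*x) / cis (2 * pi * of_int \<lfloor>x/pi\<rfloor>)"
    by (simp add: rp_emb_def rp_norm_def cis_divide algebra_simps)
  also have "cis (2 * pi * of_int \<lfloor>x/pi\<rfloor>) = 1"
    by (rule cis_multiple_2pi) simp
  finally show ?thesis
    by (simp add: rp_emb_def)
qed

lemma rp_norm_bounds: "0 \<le> rp_norm x" "rp_norm x < pi"
proof -
  have "of_int \<lfloor>x/pi\<rfloor> \<le> x/pi" "x/pi < of_int \<lfloor>x/pi\<rfloor> + 1"
    by linarith+
  then have "pi * of_int \<lfloor>x/pi\<rfloor> \<le> pi * (x/pi)" "pi * (x/pi) < pi * (of_int \<lfloor>x/pi\<rfloor> + 1)"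
    by (intro mult_left_mono mult_strict_left_mono; simp)+
  then have "pi * of_int \<lfloor>x/pi\<rfloor> \<le> x" "x < pi * of_int \<lfloor>x/pi\<rfloor> + pi"
    by (simp_all add: algebra_simps)
  then show "0 \<le> rp_norm x" "rp_norm x < pi"
    by (simp_all add: rp_norm_def)
qed

lemma rp_emb_eqE:
  assumes "rp_emb a = rp_emb b"
  obtains k :: int where "a = b + pi * of_int k"
proof -
  have "sin (2*a) = sin (2*b)" "cos (2*a) = cos (2*b)"
    using assms by (metis rp_emb_def cis.sel)+
  then obtain k :: int where "2*a = 2*b + 2 * pi * k"
    using sin_cos_eq_iff by blast
  then have "a = b + pi * of_int k"
    by simp
  then show ?thesis
    using that by blast
qed

lemma rp_emb_inj:
  assumes "0 \<le> a" "a < pi" "0 \<le> b" "b < pi" "rp_emb a = rp_emb b"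
  shows "a = b"
proof -
  obtain k :: int where k: "a = b + pi * k"
    using assms(5) by (rule rp_emb_eqE)
  moreover have "\<bar>a - b\<bar> < pi"
    using assms(1-4) by auto
  ultimately have "\<bar>real_of_int k\<bar> < 1"
    using pi_gt_zero by (simp add: abs_mult)
  then show ?thesis
    using k by simp
qed

lemma rp_emb_phi:
  assumes "det M \<noteq> 0"
  shows "rp_emb (phi M t) = proj_point (M *v dir_vec t)"
proof -
  let ?z = "complex_of_vec (M *v dir_vec t)"
  have z: "?z \<noteq> 0"
    using matrix_vector_mult_nonzero[OF assms dir_vec_nonzero] complex_of_vec_eq_0_iff by blast
  have "rp_emb (phi M t) = rp_emb (Arg ?z)"
    by (simp add: phi_def Let_def rp_emb_rp_norm dir_vec_def complex_of_vec_def)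
  also have "\<dots> = (cis (Arg ?z))\<^sup>2"
    unfolding rp_emb_def by (simp only: power2_eq_square cis_mult mult_2)
  also have "\<dots> = ?z\<^sup>2 / (complex_of_real (cmod ?z))\<^sup>2"
    using z by (simp add: cis_Arg sgn_eq power_divide)
  also have "\<dots> = proj_point (M *v dir_vec t)"
    unfolding proj_point_eq_square norm_complex_of_vec of_real_power ..
  finally show ?thesis .
qed

lemma phi_bounds: "0 \<le> phi M t" "phi M t < pi"
  by (simp_all add: phi_def Let_def rp_norm_bounds)

lemma phi_mult:
  assumes "det M \<noteq> 0" "det N \<noteq> 0"
  shows "phi M (phi N t) = phi (M ** N) t"
proof (rule rp_emb_inj[OF phi_bounds phi_bounds])
  have Nt: "N *v dir_vec t \<noteq> 0"
    using matrix_vector_mult_nonzero[OF assms(2) dir_vec_nonzero] .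
  have "proj_point (dir_vec (phi N t)) = proj_point (N *v dir_vec t)"
    using rp_emb_phi[OF assms(2)] proj_point_dir_vec by simp
  then have "det2 (dir_vec (phi N t)) (N *v dir_vec t) = 0"
    using proj_point_eq_iff[OF dir_vec_nonzero Nt] by blast
  then have "det2 (M *v dir_vec (phi N t)) (M *v (N *v dir_vec t)) = 0"
    by (simp add: det2_matrix_vector_mult)
  then have "proj_point (M *v dir_vec (phi N t)) = proj_point (M *v (N *v dir_vec t))"
    using proj_point_eq_iff matrix_vector_mult_nonzero[OF assms(1)] dir_vec_nonzero Nt by metis
  moreover have "det (M ** N) \<noteq> 0"
    using assms by (simp add: det_mul)
  ultimately show "rp_emb (phi M (phi N t)) = rp_emb (phi (M ** N) t)"
    using rp_emb_phi assms by (simp add: matrix_vector_mul_assoc)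
qed

section \<open>The derivative of the projective action\<close>

lemma rp_dist_le: "rp_dist a b \<le> \<bar>a - b - pi * of_int k\<bar>"
proof -
  have "\<bar>a - b - pi * of_int k\<bar> = pi * \<bar>(a-b)/pi - of_int k\<bar>" for k
  proof -
    have "a - b - pi * of_int k = pi * ((a-b)/pi - of_int k)"
      by (simp add: field_simps)
    then show ?thesis
      by (simp add: abs_mult)
  qed
  moreover have "\<bar>(a-b)/pi - of_int (round ((a-b)/pi))\<bar> \<le> \<bar>(a-b)/pi - of_int k\<bar>"
    by (rule round_diff_minimal)
  ultimately show ?thesis
    unfolding rp_dist_def by simp
qed

lemma rp_dist_le_abs: "rp_dist a b \<le> \<bar>a - b\<bar>"
  using rp_dist_le[of a b 0] by simp

lemma rp_dist_attained: "\<exists>k::int. rp_dist a b = \<bar>a - b - pi * of_int k\<bar>"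
  by (auto simp: rp_dist_def)

lemma rp_dist_commute: "rp_dist a b = rp_dist b a"
proof -
  have "rp_dist a b \<le> rp_dist b a" for a b
  proof -
    obtain k where "rp_dist b a = \<bar>b - a - pi * of_int k\<bar>"
      using rp_dist_attained by blast
    moreover have "rp_dist a b \<le> \<bar>a - b - pi * of_int (-k)\<bar>"
      by (rule rp_dist_le)
    ultimately show ?thesis
      by (simp add: abs_minus_commute algebra_simps)
  qed
  then show ?thesis
    by (simp add: order_antisym)
qed

lemma rp_dist_triangle: "rp_dist a c \<le> rp_dist a b + rp_dist b c"
proof -
  obtain k where k: "rp_dist a b = \<bar>a - b - pi * of_int k\<bar>"
    using rp_dist_attained by blast
  obtain l where l: "rp_dist b c = \<bar>b - c - pi * of_int l\<bar>"
    using rp_dist_attained by blast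
  have "rp_dist a c \<le> \<bar>a - c - pi * of_int (k + l)\<bar>"
    by (rule rp_dist_le)
  also have "\<dots> \<le> \<bar>a - b - pi * of_int k\<bar> + \<bar>b - c - pi * of_int l\<bar>"
    by (simp add: algebra_simps)
  finally show ?thesis
    using k l by simp
qed

lemma rp_dist_add_multiple_pi: "rp_dist (a + pi * of_int k) (b + pi * of_int l) = rp_dist a b"
proof -
  have "(a + pi * of_int k - (b + pi * of_int l)) / pi + 1/2 = ((a - b)/pi + 1/2) + of_int (k - l)"
    by (simp add: field_simps)
  then have r: "round ((a + pi * of_int k - (b + pi * of_int l)) / pi) = round ((a - b)/pi) + (k - l)"
    by (simp only: round_def floor_add_int)
  show ?thesis
    unfolding rp_dist_def r by (simp add: algebra_simps)
qed

lemma rp_dist_eq_abs: "\<bar>a - b\<bar> < pi/2 \<Longrightarrow> rp_dist a b = \<bar>a - b\<bar>"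
proof -
  assume "\<bar>a - b\<bar> < pi/2"
  then have "\<bar>(a-b)/pi\<bar> < 1/2"
    by (simp add: abs_divide field_simps)
  then have "0 \<le> (a-b)/pi + 1/2" "(a-b)/pi + 1/2 < 1"
    by linarith+
  then have "round ((a-b)/pi) = 0"
    unfolding round_def by (simp add: floor_eq_iff)
  then show ?thesis
    by (simp add: rp_dist_def)
qed

lemma rp_has_deriv_unique:
  assumes "rp_has_deriv g D1 x" "rp_has_deriv g D2 x"
  shows "D1 = D2"
proof -
  let ?e = "\<lambda>D h. rp_dist (g (x + h)) (g x + D * h) / \<bar>h\<bar>"
  have lim: "((\<lambda>h. ?e D1 h + ?e D2 h) \<longlongrightarrow> 0) (at 0)"
    using tendsto_add[OF assms[unfolded rp_has_deriv_def]] by simp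
  have small: "eventually (\<lambda>h. \<bar>D1 - D2\<bar> * \<bar>h\<bar> < pi/2) (at (0::real))"
  proof -
    have "((\<lambda>h. \<bar>D1 - D2\<bar> * \<bar>h\<bar>) \<longlongrightarrow> \<bar>D1 - D2\<bar> * \<bar>0\<bar>) (at (0::real))"
      by (intro tendsto_intros)
    then show ?thesis
      by (rule order_tendstoD) simp
  qed
  have "eventually (\<lambda>h::real. h \<noteq> 0) (at 0)"
    by (simp add: eventually_at_filter)
  with small have "eventually (\<lambda>h. \<bar>D1 - D2\<bar> \<le> ?e D1 h + ?e D2 h) (at 0)"
  proof eventually_elim
    case (elim h)
    then have "\<bar>D1 - D2\<bar> * \<bar>h\<bar> = rp_dist (g x + D1 * h) (g x + D2 * h)"
      by (subst rp_dist_eq_abs) (auto simp: abs_mult[symmetric] algebra_simps)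
    also have "\<dots> \<le> rp_dist (g (x + h)) (g x + D1 * h) + rp_dist (g (x + h)) (g x + D2 * h)"
      using rp_dist_triangle rp_dist_commute by metis
    finally show ?case
      using elim by (simp add: pos_le_divide_eq add_divide_distrib[symmetric])
  qed
  then have "\<bar>D1 - D2\<bar> \<le> 0"
    by (rule tendsto_lowerbound[OF lim]) simp
  then show ?thesis
    by simp
qed

text \<open>For det M = 1 and a fixed angle \<theta>, let y = M (cos \<theta>, sin \<theta>) and write
  M (cos t, sin t) = (p t * y + q t * perp y) / |y|^2. Near \<theta> we have p t > 0, so
  g t = Arg y + arctan (q t / p t) is a smooth lift of phi M, with g'(\<theta>) = 1 / |y|^2.\<close>

locale phi_lift =
  fixes M :: "real^2^2" and \<theta> :: real
  assumes det_M: "det M = 1"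
begin

definition "y = M *v dir_vec \<theta>"
definition "ny = (norm y)\<^sup>2"
definition "X1 t = M$1$1 * cos t + M$1$2 * sin t"
definition "X2 t = M$2$1 * cos t + M$2$2 * sin t"
definition "p t = y$1 * X1 t + y$2 * X2 t"
definition "q t = y$1 * X2 t - y$2 * X1 t"
definition "g t = Arg (complex_of_vec y) + arctan (q t / p t)"

lemma M_dir_vec_nth: "(M *v dir_vec t)$1 = X1 t" "(M *v dir_vec t)$2 = X2 t"
  by (simp_all add: matrix_vector_mult_nth_2 dir_vec_def X1_def X2_def)

lemma y_nth: "y$1 = X1 \<theta>" "y$2 = X2 \<theta>"
  by (simp_all add: y_def M_dir_vec_nth)

lemma y_nonzero: "y \<noteq> 0"
  unfolding y_def using det_M by (simp add: matrix_vector_mult_nonzero dir_vec_nonzero)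

lemma ny_pos: "ny > 0"
  using y_nonzero by (simp add: ny_def)

lemma p_\<theta>: "p \<theta> = ny"
  by (simp add: p_def ny_def norm_vec2 y_nth power2_eq_square)

lemma q_\<theta>: "q \<theta> = 0"
  by (simp add: q_def y_nth)

lemma complex_of_vec_M_dir_vec:
  "complex_of_vec (M *v dir_vec t) * of_real ny = (of_real (p t) + \<i> * of_real (q t)) * complex_of_vec y"
  by (simp add: complex_of_vec_def complex_eq_iff M_dir_vec_nth p_def q_def ny_def norm_vec2
      power2_eq_square algebra_simps)

lemma rp_emb_g: "p t \<noteq> 0 \<Longrightarrow> rp_emb (g t) = rp_emb (phi M t)"
proof -
  assume pt: "p t \<noteq> 0"
  define s where "s = q t / p t"
  define \<beta> where "\<beta> = Arg (complex_of_vec y)"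
  have y: "complex_of_vec y = of_real (norm y) * cis \<beta>"
    using y_nonzero by (simp add: \<beta>_def cis_Arg sgn_eq norm_complex_of_vec complex_of_vec_eq_0_iff)
  have s2: "sqrt (1 + s\<^sup>2) > 0"
    by (simp add: add_pos_nonneg)
  have pq: "of_real (p t) + \<i> * of_real (q t) = of_real (p t) * (of_real (sqrt (1 + s\<^sup>2)) * cis (arctan s))"
    using pt s2 by (simp add: s_def complex_eq_iff cos_arctan sin_arctan field_simps)
  have "complex_of_vec (M *v dir_vec t) = (of_real (p t) + \<i> * of_real (q t)) * complex_of_vec y / of_real ny"
    using complex_of_vec_M_dir_vec[of t] ny_pos by (simp add: field_simps)
  also have "\<dots> = of_real (p t * sqrt (1 + s\<^sup>2) * norm y / ny) * (cis (arctan s) * cis \<beta>)"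
    unfolding pq y by (simp add: field_simps)
  also have "cis (arctan s) * cis \<beta> = cis (g t)"
    by (simp add: cis_mult g_def s_def \<beta>_def add.commute)
  finally have "complex_of_vec (M *v dir_vec t) = of_real (p t * sqrt (1 + s\<^sup>2) * norm y / ny) * cis (g t)" .
  moreover have "p t * sqrt (1 + s\<^sup>2) * norm y / ny \<noteq> 0"
    using pt y_nonzero ny_pos s2 by simp
  ultimately have "proj_point (M *v dir_vec t) = rp_emb (g t)"
    by (rule proj_point_polar)
  then show ?thesis
    using rp_emb_phi det_M by simp
qed

lemma g_has_derivative: "(g has_real_derivative (1 / ny)) (at \<theta>)"
proof -
  define X1' where "X1' t = - M$1$1 * sin t + M$1$2 * cos t" for t
  define X2' where "X2' t = - M$2$1 * sin t + M$2$2 * cos t" for t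
  have dp: "(p has_real_derivative (y$1 * X1' \<theta> + y$2 * X2' \<theta>)) (at \<theta>)"
    unfolding p_def[abs_def] X1_def X2_def X1'_def X2'_def
    by (auto intro!: derivative_eq_intros simp: algebra_simps)
  have dq: "(q has_real_derivative (y$1 * X2' \<theta> - y$2 * X1' \<theta>)) (at \<theta>)"
    unfolding q_def[abs_def] X1_def X2_def X1'_def X2'_def
    by (auto intro!: derivative_eq_intros simp: algebra_simps)
  have "y$1 * X2' \<theta> - y$2 * X1' \<theta> = det M * ((sin \<theta>)\<^sup>2 + (cos \<theta>)\<^sup>2)"
    by (simp only: y_nth X1_def X2_def X1'_def X2'_def det_2) algebra
  then have "y$1 * X2' \<theta> - y$2 * X1' \<theta> = 1"
    using det_M by simp
  then show ?thesis
    unfolding g_def[abs_def] using ny_pos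
    by (auto intro!: derivative_eq_intros dp dq simp: p_\<theta> q_\<theta>)
qed

lemma eventually_p_pos: "eventually (\<lambda>h. p (\<theta> + h) > 0) (at 0)"
proof -
  have "isCont p \<theta>"
    unfolding p_def[abs_def] X1_def X2_def by (intro continuous_intros)
  then have "((\<lambda>h. p (\<theta> + h)) \<longlongrightarrow> p \<theta>) (at 0)"
    by (simp add: isCont_def LIM_offset_zero)
  then show ?thesis
    using ny_pos p_\<theta> by (auto intro: order_tendstoD)
qed

lemma rp_has_deriv_phi: "rp_has_deriv (phi M) (1 / ny) \<theta>"
  unfolding rp_has_deriv_def
proof (rule tendsto_sandwich[where f = "\<lambda>_. 0"])
  let ?u = "\<lambda>h. \<bar>(g (\<theta> + h) - g \<theta>) / h - 1 / ny\<bar>"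
  have "((\<lambda>h. (g (\<theta> + h) - g \<theta>) / h) \<longlongrightarrow> 1 / ny) (at 0)"
    using g_has_derivative by (simp add: DERIV_def)
  then show "(?u \<longlongrightarrow> 0) (at 0)"
    by (intro tendsto_rabs_zero LIM_zero)
  obtain k2 :: int where k2: "phi M \<theta> = g \<theta> + pi * k2"
    using rp_emb_g[of \<theta>] ny_pos p_\<theta> by (auto elim: rp_emb_eqE[OF sym])
  have "eventually (\<lambda>h::real. h \<noteq> 0) (at 0)"
    by (simp add: eventually_at_filter)
  with eventually_p_pos
  show "eventually (\<lambda>h. rp_dist (phi M (\<theta> + h)) (phi M \<theta> + 1 / ny * h) / \<bar>h\<bar> \<le> ?u h) (at 0)"
  proof eventually_elim
    case (elim h)
    obtain k1 :: int where k1: "phi M (\<theta> + h) = g (\<theta> + h) + pi * k1"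
      using rp_emb_g[of "\<theta> + h"] elim by (auto elim: rp_emb_eqE[OF sym])
    have "rp_dist (phi M (\<theta> + h)) (phi M \<theta> + 1 / ny * h) = rp_dist (g (\<theta> + h)) (g \<theta> + 1 / ny * h)"
      using rp_dist_add_multiple_pi[of "g (\<theta> + h)" k1 "g \<theta> + 1 / ny * h" k2]
      by (simp add: k1 k2 algebra_simps)
    also have "\<dots> \<le> \<bar>g (\<theta> + h) - (g \<theta> + 1 / ny * h)\<bar>"
      by (rule rp_dist_le_abs)
    also have "\<dots> = ?u h * \<bar>h\<bar>"
      using elim by (simp add: abs_mult[symmetric] field_simps)
    finally show ?case
      using elim by (simp add: pos_divide_le_eq)
  qed
qed (simp_all add: rp_dist_def)

end

lemma rp_deriv_phi:
  assumes "det M = 1"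
  shows "rp_deriv (phi M) t = 1 / (norm (M *v dir_vec t))\<^sup>2"
proof -
  interpret phi_lift M t
    using assms by unfold_locales
  have "rp_deriv (phi M) t = 1 / ny"
    unfolding rp_deriv_def using rp_has_deriv_phi rp_has_deriv_unique by blast
  then show ?thesis
    by (simp add: ny_def y_def)
qed

section \<open>Operator norms of plane matrices\<close>

lemma norm_matrix_vector_mult_le: "norm ((M::real^'n^'m) *v x) \<le> onorm ((*v) M) * norm x"
  by (rule onorm[OF matrix_vector_mul_bounded_linear])

lemma onorm_matrix_mult_le: "onorm ((*v) ((M::real^'n^'m) ** (N::real^'k^'n))) \<le> onorm ((*v) M) * onorm ((*v) N)"
proof -
  have "(*v) (M ** N) = (*v) M \<circ> (*v) N"
    by (auto simp: matrix_vector_mul_assoc)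
  then show ?thesis
    by (metis onorm_compose matrix_vector_mul_bounded_linear)
qed

lemma onorm_matrix_nonneg: "0 \<le> onorm ((*v) (M::real^'n^'m))"
  by (rule onorm_pos_le[OF matrix_vector_mul_bounded_linear])

lemma onorm_mat_1: "onorm ((*v) (mat 1 :: real^'n^'n)) = 1"
proof -
  have "(*v) (mat 1 :: real^'n^'n) = (\<lambda>x. x)"
    by (rule ext) simp
  then show ?thesis
    by (simp add: onorm_id)
qed

text \<open>A plane matrix of determinant 1 preserves areas, so it cannot contract any vector by more than
  the factor 1 / |M|.\<close>

lemma norm_le_onorm_mult_norm_image:
  assumes "det M = 1"
  shows "norm v \<le> onorm ((*v) (M::real^2^2)) * norm (M *v v)"
proof -
  have "(norm v)\<^sup>2 = \<bar>det2 (M *v v) (M *v perp v)\<bar>"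
    by (simp add: det2_matrix_vector_mult assms det2_perp)
  also have "\<dots> \<le> norm (M *v v) * norm (M *v perp v)"
    by (rule abs_det2_le)
  also have "\<dots> \<le> norm (M *v v) * (onorm ((*v) M) * norm v)"
    using norm_matrix_vector_mult_le[of M "perp v"] by (intro mult_left_mono) (auto simp: norm_perp)
  finally have "norm v * norm v \<le> (onorm ((*v) M) * norm (M *v v)) * norm v"
    by (simp add: power2_eq_square algebra_simps)
  then show ?thesis
    by (cases "norm v = 0") (auto simp: mult_le_cancel_right)
qed

lemma onorm_ge_1:
  assumes "det M = 1"
  shows "1 \<le> onorm ((*v) (M::real^2^2))"
proof -
  have "1 \<le> onorm ((*v) M) * norm (M *v dir_vec 0)"
    using norm_le_onorm_mult_norm_image[OF assms, of "dir_vec 0"] by (simp add: norm_dir_vec)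
  also have "\<dots> \<le> onorm ((*v) M) * onorm ((*v) M)"
    using norm_matrix_vector_mult_le[of M "dir_vec 0"]
    by (intro mult_left_mono) (auto simp: norm_dir_vec onorm_matrix_nonneg)
  finally have "1 \<le> (onorm ((*v) M))\<^sup>2"
    by (simp add: power2_eq_square)
  then show ?thesis
    using power2_le_imp_le[of 1 "onorm ((*v) M)"] onorm_matrix_nonneg[of M] by simp
qed

lemma onorm_mult_norm_le_frame:
  assumes "v \<noteq> 0"
  shows "onorm ((*v) (M::real^2^2)) * norm v \<le> norm (M *v v) + norm (M *v perp v)"
proof -
  let ?P = "M *v v" and ?Q = "M *v perp v"
  have nv: "norm v > 0"
    using assms by simp
  have "norm (M *v x) \<le> (norm ?P + norm ?Q) / norm v * norm x" for x
  proof -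
    have "M *v x = ((x \<bullet> v) / (norm v)\<^sup>2) *\<^sub>R ?P + (det2 v x / (norm v)\<^sup>2) *\<^sub>R ?Q"
      using vec2_decomp[OF assms, of x]
      by (metis matrix_vector_right_distrib matrix_vector_mult_scaleR)
    then have "norm (M *v x) \<le> \<bar>x \<bullet> v\<bar> / (norm v)\<^sup>2 * norm ?P + \<bar>det2 v x\<bar> / (norm v)\<^sup>2 * norm ?Q"
      by (metis norm_triangle_ineq norm_scaleR abs_divide abs_power2)
    also have "\<dots> \<le> (norm x * norm v) / (norm v)\<^sup>2 * norm ?P + (norm x * norm v) / (norm v)\<^sup>2 * norm ?Q"
      using Cauchy_Schwarz_ineq2[of x v] abs_det2_le[of v x]
      by (intro add_mono mult_right_mono divide_right_mono) (auto simp: mult.commute)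
    also have "\<dots> = (norm ?P + norm ?Q) / norm v * norm x"
      using nv by (simp add: power2_eq_square field_simps)
    finally show ?thesis .
  qed
  then have "onorm ((*v) M) \<le> (norm ?P + norm ?Q) / norm v"
    by (intro onorm_le)
  then show ?thesis
    using nv by (simp add: pos_le_divide_eq)
qed

lemma det2_pair_lower_bound:
  assumes "norm z1 = 1" "norm z2 = 1"
  shows "\<bar>det2 z1 z2\<bar> * norm x \<le> \<bar>det2 z1 x\<bar> + \<bar>det2 z2 x\<bar>"
proof -
  have "\<bar>det2 z1 z2\<bar> * norm x = norm (det2 x z2 *\<^sub>R z1 + det2 z1 x *\<^sub>R z2)"
    by (simp flip: vec2_cramer)
  also have "\<dots> \<le> \<bar>det2 x z2\<bar> + \<bar>det2 z1 x\<bar>"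
    using norm_triangle_ineq[of "det2 x z2 *\<^sub>R z1" "det2 z1 x *\<^sub>R z2"] assms by simp
  finally show ?thesis
    by (simp add: det2_swap[of x z2] add.commute)
qed

lemma exists_small_angle_cancel:
  assumes "0 < d" "d < pi/2" "\<bar>a\<bar> < tan d * \<bar>b\<bar>"
  shows "\<exists>t. \<bar>t\<bar> < d \<and> cos t * a + sin t * b = 0"
proof -
  have b: "b \<noteq> 0"
    using assms(3) by auto
  define t where "t = arctan (- a / b)"
  have "\<bar>- a / b\<bar> < tan d"
    using assms(3) b by (simp add: abs_divide pos_divide_less_eq)
  then have "arctan \<bar>- a / b\<bar> < arctan (tan d)"
    by (simp add: arctan_less_iff)
  also have "arctan (tan d) = d"
    using assms by (intro arctan_tan) auto
  finally have "\<bar>t\<bar> < d"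
    unfolding t_def by (metis abs_if arctan_minus arctan_less_iff arctan_zero_zero)
  moreover have "sin t = (- a / b) * cos t"
    using tan_arctan[of "- a / b"] cos_arctan_not_zero[of "- a / b"]
    by (simp add: t_def tan_def field_simps)
  then have "cos t * a + sin t * b = 0"
    using b by (simp add: field_simps)
  ultimately show ?thesis
    by blast
qed

text \<open>If M maps the whole sector of half-angle d around v off two independent directions z1, z2, then
  M v is not much shorter than M applied to the most expanded direction: otherwise M v would be tiny
  compared to M (perp v), and some rotation of v inside the sector would be mapped onto z1 or z2.\<close>

lemma norm_image_ge_if_sector_avoids:
  fixes M :: "real^2^2"
  assumes v: "v \<noteq> 0" and d: "0 < d" "d < pi/2"
    and z: "norm z1 = 1" "norm z2 = 1" "det2 z1 z2 \<noteq> 0"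
    and avoids: "\<And>t. \<bar>t\<bar> < d \<Longrightarrow> det2 z1 (M *v rot t v) \<noteq> 0 \<and> det2 z2 (M *v rot t v) \<noteq> 0"
  shows "min (1/2) (\<bar>det2 z1 z2\<bar> * tan d / 4) * onorm ((*v) M) * norm v \<le> norm (M *v v)"
proof (rule ccontr)
  define N where "N = onorm ((*v) M) * norm v"
  define P where "P = M *v v"
  define Q where "Q = M *v perp v"
  define s where "s = \<bar>det2 z1 z2\<bar>"
  define c where "c = min (1/2) (s * tan d / 4)"
  have s: "s > 0"
    using z by (simp add: s_def)
  have td: "tan d > 0"
    using d by (simp add: tan_gt_zero)
  have N0: "N \<ge> 0"
    by (simp add: N_def onorm_matrix_nonneg)
  assume "\<not> c * onorm ((*v) M) * norm v \<le> norm (M *v v)"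
  then have P_small: "norm P < c * N"
    by (simp add: N_def P_def mult.assoc)
  have "N \<le> norm P + norm Q"
    unfolding N_def P_def Q_def by (rule onorm_mult_norm_le_frame[OF v])
  moreover have "c * N \<le> N / 2"
    using mult_right_mono[of c "1/2" N] N0 by (simp add: c_def)
  ultimately have Q_big: "N < 2 * norm Q"
    using P_small by linarith
  obtain z where z_cases: "z = z1 \<or> z = z2" and zQ: "s * norm Q \<le> 2 * \<bar>det2 z Q\<bar>"
    using det2_pair_lower_bound[OF z(1,2), of Q] unfolding s_def
    by (cases "\<bar>det2 z1 Q\<bar> \<le> \<bar>det2 z2 Q\<bar>") (metis mult_2 add_mono order_trans order_refl linear)+
  have "\<bar>det2 z P\<bar> < tan d * \<bar>det2 z Q\<bar>"
  proof -
    have "\<bar>det2 z P\<bar> \<le> norm P"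
      using abs_det2_le[of z P] z z_cases by auto
    also have "\<dots> < c * N"
      by (rule P_small)
    also have "\<dots> \<le> (s * tan d / 4) * (2 * norm Q)"
      using Q_big N0 s td by (intro mult_mono) (auto simp: c_def)
    also have "\<dots> \<le> tan d * \<bar>det2 z Q\<bar>"
      using zQ td by (simp add: algebra_simps mult_left_mono)
    finally show ?thesis .
  qed
  then obtain t where t: "\<bar>t\<bar> < d" "cos t * det2 z P + sin t * det2 z Q = 0"
    using exists_small_angle_cancel[OF d] by blast
  then have "det2 z (M *v rot t v) = 0"
    by (simp add: matrix_vector_mult_rot det2_linear_right P_def Q_def)
  then show False
    using avoids[OF t(1)] z_cases by auto
qed

section \<open>Products along words\<close>

lemma mat_word_Nil [simp]: "mat_word A [] = mat 1"
  by (simp add: mat_word_def)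

lemma mat_word_Cons [simp]: "mat_word A (i # w) = A i ** mat_word A w"
  by (simp add: mat_word_def)

lemma mat_word_append: "mat_word A (xs @ ys) = mat_word A xs ** mat_word A ys"
  by (induction xs) (simp_all add: matrix_mul_assoc)

lemma det_mat_word: "(\<And>i. det (A i) = 1) \<Longrightarrow> det (mat_word A w) = 1"
  by (induction w) (simp_all add: det_mul det_I)

lemma phi_word_eq_phi_mat_word:
  assumes "\<And>i. det (A i) = 1" "w \<noteq> []"
  shows "phi_word A w = phi (mat_word A w)"
  using assms(2)
proof (induction w)
  case (Cons i w)
  show ?case
  proof (cases "w = []")
    case True
    then show ?thesis
      by (simp add: phi_word_def mat_word_def)
  next
    case False
    have "phi_word A (i # w) = phi (A i) \<circ> phi (mat_word A w)"
      using Cons.IH False by (simp add: phi_word_def)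
    also have "\<dots> = phi (mat_word A (i # w))"
      by (rule ext) (simp add: phi_mult assms(1) det_mat_word)
    finally show ?thesis .
  qed
qed simp

section \<open>Strictly invariant multicones\<close>

locale multicone_system =
  fixes A :: "'i::finite \<Rightarrow> real^2^2" and U :: "complex set"
  assumes det_A: "\<And>i. det (A i) = 1"
    and multicone: "strictly_invariant_multicone A U"
begin

lemma det_mat_word_A: "det (mat_word A w) = 1"
  using det_A by (rule det_mat_word)

lemma U_subset_sphere: "U \<subseteq> sphere 0 1"
  using multicone openin_subset by (force simp: strictly_invariant_multicone_def)

lemma closure_U_subset_sphere: "closure U \<subseteq> sphere 0 1"
  using U_subset_sphere closure_minimal closed_sphere by blast

lemma proj_point_maps_closure_into:
  assumes "v \<noteq> 0" "proj_point v \<in> closure U"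
  shows "proj_point (A i *v v) \<in> U"
proof -
  define t where "t = Arg (complex_of_vec v)"
  have v: "v = norm v *\<^sub>R dir_vec t" and nv: "norm v \<noteq> 0"
    using polar_dir_vec[OF assms(1)] assms(1) by (simp_all add: t_def)
  then have "proj_point v = rp_emb t"
    by (metis proj_point_scaleR proj_point_dir_vec)
  then have "rp_emb (phi (A i) t) \<in> U"
    using multicone assms(2) by (simp add: strictly_invariant_multicone_def)
  then have "proj_point (A i *v dir_vec t) \<in> U"
    using rp_emb_phi det_A by simp
  moreover have "A i *v v = norm v *\<^sub>R (A i *v dir_vec t)"
    by (subst v) (simp add: matrix_vector_mult_scaleR)
  ultimately show ?thesis
    using proj_point_scaleR[OF nv] by simp
qed

lemma proj_point_mat_word_in:
  assumes "v \<noteq> 0" "proj_point v \<in> U"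
  shows "proj_point (mat_word A w *v v) \<in> U"
proof (induction w)
  case Nil
  then show ?case
    using assms by simp
next
  case (Cons i w)
  have "mat_word A w *v v \<noteq> 0"
    using matrix_vector_mult_nonzero det_mat_word_A assms(1) by simp
  then have "proj_point (A i *v (mat_word A w *v v)) \<in> U"
    using Cons closure_subset by (blast intro: proj_point_maps_closure_into)
  then show ?case
    by (simp add: matrix_vector_mul_assoc)
qed

lemma exists_unit_vec_in: "\<exists>v. norm v = 1 \<and> proj_point v \<in> U"
proof -
  have "U \<noteq> {}"
    using multicone by (simp add: strictly_invariant_multicone_def)
  then obtain z where "z \<in> U"
    by blast
  then have "proj_point (dir_vec (Arg z / 2)) \<in> U"
    using U_subset_sphere proj_point_dir_vec_Arg by auto
  then show ?thesis
    using norm_dir_vec by blast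
qed

text \<open>Strict invariance forces a gap: since A i is onto, every point of the circle is the image of some
  point, so the circle cannot be contained in the closure of U.\<close>

lemma closure_U_neq_sphere: "closure U \<noteq> sphere 0 1"
proof
  assume eq: "closure U = sphere 0 1"
  have "U \<noteq> sphere 0 1"
    using multicone by (simp add: strictly_invariant_multicone_def)
  then obtain z where z: "z \<in> sphere 0 1" "z \<notin> U"
    using U_subset_sphere by blast
  define M where "M = A undefined"
  define y where "y = dir_vec (Arg z / 2)"
  define v :: "real^2" where "v = vector [M$2$2 * y$1 - M$1$2 * y$2, - M$2$1 * y$1 + M$1$1 * y$2]"
  have Mv: "M *v v = y"
    using det_A[of undefined]
    by (simp add: v_def M_def[symmetric] vec_eq_iff forall_2 matrix_vector_mult_nth_2 det_2 algebra_simps)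
  then have "v \<noteq> 0"
    using dir_vec_nonzero y_def by force
  moreover have "proj_point v \<in> closure U"
    using eq norm_proj_point[OF \<open>v \<noteq> 0\<close>] by simp
  ultimately have "proj_point (M *v v) \<in> U"
    unfolding M_def by (rule proj_point_maps_closure_into)
  then show False
    using z Mv proj_point_dir_vec_Arg y_def by auto
qed

lemma exists_independent_directions_outside:
  "\<exists>z1 z2. norm z1 = 1 \<and> norm z2 = 1 \<and> det2 z1 z2 \<noteq> 0 \<and> proj_point z1 \<notin> U \<and> proj_point z2 \<notin> U"
proof -
  obtain q where q: "q \<in> sphere 0 1" "q \<notin> closure U"
    using closure_U_neq_sphere closure_U_subset_sphere by blast
  obtain e where e: "e > 0" "ball q e \<subseteq> - closure U"
    using q open_contains_ball[of "- closure U"] by blast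
  define z1 where "z1 = dir_vec (Arg q / 2)"
  define s where "s = min (e/4) 1"
  define z2 where "z2 = rot s z1"
  have s: "0 < s" "s \<le> 1" "s \<le> e/4"
    using e by (auto simp: s_def)
  have n1: "norm z1 = 1" and n2: "norm z2 = 1"
    by (simp_all add: z1_def z2_def norm_dir_vec norm_rot)
  have pz1: "proj_point z1 = q"
    using q by (simp add: z1_def proj_point_dir_vec_Arg)
  have "dist (proj_point z2) q \<le> \<bar>2 * s\<bar>"
    using dist_cis_mult_self[of q] q(1) by (simp add: z2_def proj_point_rot pz1)
  then have "proj_point z2 \<in> ball q e"
    using s e by (simp add: dist_commute)
  moreover have "det2 z1 z2 = sin s"
    using n1 by (simp add: z2_def rot_def det2_linear_right det2_perp det2_def[of z1 z1])
  moreover have "sin s > 0"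
    using s pi_gt3 by (intro sin_gt_zero) auto
  ultimately have "proj_point z2 \<notin> closure U" "det2 z1 z2 \<noteq> 0"
    using e by auto
  then show ?thesis
    using n1 n2 pz1 q closure_subset by blast
qed

text \<open>The images of closure U under the finitely many A i form a compact subset of the open set U,
  so they keep a uniform distance from the complement of U.\<close>

lemma uniform_image_margin:
  "\<exists>e>0. \<forall>i v z. v \<noteq> 0 \<longrightarrow> proj_point v \<in> closure U \<longrightarrow> cmod z = 1 \<longrightarrow>
      dist z (proj_point (A i *v v)) < e \<longrightarrow> z \<in> U"
proof -
  define V where "V = sphere (0::real^2) 1 \<inter> proj_point -` closure U"
  have cont: "continuous_on (sphere (0::real^2) 1) proj_point"
    by (rule continuous_on_subset[OF continuous_on_proj_point]) auto
  have "compact V"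
    unfolding V_def compact_eq_bounded_closed
    by (auto intro: continuous_closed_preimage[OF cont] bounded_subset[of "sphere 0 1"])
  define W where "W = (\<Union>i. (\<lambda>v. proj_point (A i *v v)) ` V)"
  have "compact W"
    unfolding W_def
  proof (intro compact_UN compact_continuous_image continuous_on_compose2[OF continuous_on_proj_point])
    show "continuous_on V ((*v) (A i))" for i
      by (rule linear_continuous_on) simp
    show "(*v) (A i) ` V \<subseteq> {v. v \<noteq> 0}" for i
      using matrix_vector_mult_nonzero det_A by (auto simp: V_def) (metis norm_zero zero_neq_one)
  qed (simp_all add: \<open>compact V\<close>)
  obtain T where T: "open T" "U = sphere 0 1 \<inter> T"
    using multicone by (auto simp: strictly_invariant_multicone_def openin_open)
  have "W \<subseteq> U"
    by (auto simp: W_def V_def intro!: proj_point_maps_closure_into)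
  then obtain e where e: "e > 0" "(\<Union>x\<in>W. ball x e) \<subseteq> T"
    using compact_subset_open_imp_ball_epsilon_subset[OF \<open>compact W\<close> T(1)] T(2) by blast
  have "z \<in> U"
    if v: "v \<noteq> 0" "proj_point v \<in> closure U" and z: "cmod z = 1" "dist z (proj_point (A i *v v)) < e"
    for i v z
  proof -
    define v' where "v' = (1 / norm v) *\<^sub>R v"
    have "v' \<in> V"
      using v by (simp add: V_def v'_def proj_point_scaleR)
    moreover have "A i *v v = norm v *\<^sub>R (A i *v v')"
      using v by (simp add: v'_def matrix_vector_mult_scaleR)
    ultimately have "proj_point (A i *v v) \<in> W"
      using v by (auto simp: W_def proj_point_scaleR)
    then have "z \<in> (\<Union>x\<in>W. ball x e)"
      using z(2) by (auto simp: dist_commute)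
    then have "z \<in> T"
      using e(2) by blast
    then show ?thesis
      using T z(1) by simp
  qed
  then show ?thesis
    using e(1) by blast
qed

lemma uniform_sector_margin:
  "\<exists>d>0. d < pi/2 \<and> (\<forall>i v t. v \<noteq> 0 \<longrightarrow> proj_point v \<in> closure U \<longrightarrow> \<bar>t\<bar> < d \<longrightarrow>
      proj_point (rot t (A i *v v)) \<in> U)"
proof -
  obtain e where e: "e > 0" and margin: "\<And>i v z. v \<noteq> 0 \<Longrightarrow> proj_point v \<in> closure U \<Longrightarrow> cmod z = 1 \<Longrightarrow>
      dist z (proj_point (A i *v v)) < e \<Longrightarrow> z \<in> U"
    using uniform_image_margin by blast
  define d where "d = min (e/2) 1"
  have d: "d > 0" "d < pi/2"
    using e pi_gt3 by (auto simp: d_def)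
  have "proj_point (rot t (A i *v v)) \<in> U"
    if v: "v \<noteq> 0" "proj_point v \<in> closure U" and t: "\<bar>t\<bar> < d" for i v t
  proof (rule margin[OF v])
    have Av: "A i *v v \<noteq> 0"
      using matrix_vector_mult_nonzero det_A v by simp
    then show "cmod (proj_point (rot t (A i *v v))) = 1"
      using norm_rot norm_proj_point by (metis norm_eq_zero)
    have "dist (proj_point (rot t (A i *v v))) (proj_point (A i *v v)) \<le> \<bar>2*t\<bar>"
      using dist_cis_mult_self[OF norm_proj_point[OF Av]] by (simp add: proj_point_rot)
    also have "\<bar>2*t\<bar> < e"
      using t by (simp add: d_def abs_mult)
    finally show "dist (proj_point (rot t (A i *v v))) (proj_point (A i *v v)) < e" .
  qed
  then show ?thesis
    using d by blast
qed

text \<open>A i maps v into U together with the whole sector of angle d around A i v; the product M keeps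
  that sector inside U, hence away from two fixed independent directions outside U.\<close>

lemma norm_mat_word_image_ge:
  "\<exists>c>0. c \<le> 1 \<and> (\<forall>w i v. v \<noteq> 0 \<longrightarrow> proj_point v \<in> closure U \<longrightarrow>
     c * onorm ((*v) (mat_word A w)) * norm (A i *v v) \<le> norm (mat_word A w *v (A i *v v)))"
proof -
  obtain z1 z2 where z: "norm z1 = 1" "norm z2 = 1" "det2 z1 z2 \<noteq> 0" "proj_point z1 \<notin> U" "proj_point z2 \<notin> U"
    using exists_independent_directions_outside by blast
  obtain d where d: "d > 0" "d < pi/2"
    and margin: "\<And>i v t. v \<noteq> 0 \<Longrightarrow> proj_point v \<in> closure U \<Longrightarrow> \<bar>t\<bar> < d \<Longrightarrow> proj_point (rot t (A i *v v)) \<in> U"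
    using uniform_sector_margin by blast
  define c where "c = min (1/2) (\<bar>det2 z1 z2\<bar> * tan d / 4)"
  have "c * onorm ((*v) M) * norm (A i *v v) \<le> norm (M *v (A i *v v))"
    if v: "v \<noteq> 0" "proj_point v \<in> closure U" and M: "M = mat_word A w" for M w i v
    unfolding c_def
  proof (rule norm_image_ge_if_sector_avoids[OF _ d z(1-3)])
    show Av: "A i *v v \<noteq> 0"
      using matrix_vector_mult_nonzero det_A v by simp
    fix t :: real
    assume "\<bar>t\<bar> < d"
    then have "proj_point (rot t (A i *v v)) \<in> U"
      using margin v by simp
    moreover have "rot t (A i *v v) \<noteq> 0"
      using Av norm_rot by (metis norm_eq_zero)
    ultimately have "proj_point (M *v rot t (A i *v v)) \<in> U"
      unfolding M by (rule proj_point_mat_word_in[rotated])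
    moreover have "M *v rot t (A i *v v) \<noteq> 0"
      using matrix_vector_mult_nonzero det_mat_word_A \<open>rot t (A i *v v) \<noteq> 0\<close> by (simp add: M)
    ultimately show "det2 z1 (M *v rot t (A i *v v)) \<noteq> 0 \<and> det2 z2 (M *v rot t (A i *v v)) \<noteq> 0"
      using proj_point_eq_iff[of z1] proj_point_eq_iff[of z2] z by (metis norm_zero zero_neq_one)
  qed
  moreover have "c > 0" "c \<le> 1"
    using z(3) d by (auto simp: c_def tan_gt_zero)
  ultimately show ?thesis
    by blast
qed

lemma cone_norm_comparison:
  "\<exists>c>0. \<forall>w v. v \<noteq> 0 \<longrightarrow> proj_point v \<in> closure U \<longrightarrow>
     c * onorm ((*v) (mat_word A w)) * norm v \<le> norm (mat_word A w *v v)"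
proof -
  obtain c0 where c0: "c0 > 0" "c0 \<le> 1"
    and image: "\<And>w i v. v \<noteq> 0 \<Longrightarrow> proj_point v \<in> closure U \<Longrightarrow>
      c0 * onorm ((*v) (mat_word A w)) * norm (A i *v v) \<le> norm (mat_word A w *v (A i *v v))"
    using norm_mat_word_image_ge by blast
  define L where "L = Max (range (\<lambda>i. onorm ((*v) (A i))))"
  have L: "onorm ((*v) (A i)) \<le> L" for i
    unfolding L_def by (rule Max_ge) auto
  have L1: "1 \<le> L"
    using L onorm_ge_1[OF det_A] order_trans by blast
  define c where "c = c0 / L\<^sup>2"
  have c: "c > 0" "c \<le> 1"
    using c0 L1 by (auto simp: c_def field_simps intro: order_trans[OF _ one_le_power])
  have "c * onorm ((*v) (mat_word A w)) * norm v \<le> norm (mat_word A w *v v)"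
    if v: "v \<noteq> 0" "proj_point v \<in> closure U" for w v
  proof (cases w rule: rev_exhaust)
    case Nil
    then show ?thesis
      using c mult_right_mono[of c 1 "norm v"] by (simp add: onorm_mat_1)
  next
    case (snoc w' i)
    define M where "M = mat_word A w'"
    have "onorm ((*v) (mat_word A w)) \<le> onorm ((*v) M) * L"
      using onorm_matrix_mult_le[of M "A i"] L[of i] onorm_matrix_nonneg[of M]
      by (simp add: snoc mat_word_append M_def) (meson mult_left_mono order_trans)
    moreover have "norm v \<le> L * norm (A i *v v)"
      using norm_le_onorm_mult_norm_image[OF det_A, of v i] L[of i]
      by (meson mult_right_mono norm_ge_zero order_trans)
    ultimately have "c * onorm ((*v) (mat_word A w)) * norm v \<le> c * (onorm ((*v) M) * L) * (L * norm (A i *v v))"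
      using c L1 by (intro mult_mono mult_left_mono) (auto simp: onorm_matrix_nonneg)
    also have "\<dots> = c0 * onorm ((*v) M) * norm (A i *v v)"
      using L1 by (simp add: c_def power2_eq_square)
    also have "\<dots> \<le> norm (mat_word A w *v v)"
      using image[OF v, of w' i] by (simp add: snoc mat_word_append M_def matrix_vector_mul_assoc)
    finally show ?thesis .
  qed
  then show ?thesis
    using c by blast
qed

end

section \<open>Almost additive sequences\<close>

lemma almost_additive_slope_bounds:
  fixes E :: "nat \<Rightarrow> real"
  assumes sub: "\<And>n m. E (n + m) \<le> E n + E m"
    and sup: "\<And>n m. E n + E m - \<kappa> \<le> E (n + m)"
    and nonneg: "\<And>n. 0 \<le> E n" and E_0: "E 0 = 0"
  shows "\<exists>\<gamma>. \<forall>m\<ge>1. \<gamma> \<le> E m / m \<and> (E m - \<kappa>) / m \<le> \<gamma>"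
proof -
  have upper: "E (k * j) \<le> real k * E j" for k j
  proof (induction k)
    case (Suc k)
    then show ?case
      using sub[of j "k * j"] by (simp add: algebra_simps)
  qed (simp add: E_0)
  have lower: "real k * (E m - \<kappa>) \<le> E (k * m)" for k m
  proof (induction k)
    case (Suc k)
    then show ?case
      using sup[of m "k * m"] by (simp add: algebra_simps)
  qed (simp add: E_0)
  define \<gamma> where "\<gamma> = Inf ((\<lambda>m. E m / real m) ` {1..})"
  have "\<gamma> \<le> E m / m \<and> (E m - \<kappa>) / m \<le> \<gamma>" if m: "m \<ge> 1" for m
  proof
    show "\<gamma> \<le> E m / m"
      unfolding \<gamma>_def using m nonneg by (intro cInf_lower bdd_belowI[of _ 0]) auto
    show "(E m - \<kappa>) / m \<le> \<gamma>"
      unfolding \<gamma>_def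
    proof (rule cInf_greatest)
      fix y
      assume "y \<in> (\<lambda>m. E m / real m) ` {1..}"
      then obtain j where j: "j \<ge> 1" "y = E j / j"
        by auto
      have "(E m - \<kappa>) / m = (real j * (E m - \<kappa>)) / (real j * real m)"
        using j by simp
      also have "\<dots> \<le> (real m * E j) / (real j * real m)"
        using lower[of j m] upper[of m j] by (intro divide_right_mono) (simp_all add: mult.commute)
      also have "\<dots> = y"
        using j m by simp
      finally show "(E m - \<kappa>) / m \<le> y" .
    qed auto
  qed
  then show ?thesis
    by blast
qed

lemma tendsto_real_div_over_n:
  assumes "m \<ge> 1"
  shows "(\<lambda>n. real (n div m) / real n) \<longlonglongrightarrow> 1 / real m"
proof -
  have "(\<lambda>n. real (n mod m) / (real m * real n)) \<longlonglongrightarrow> 0"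
  proof (rule tendsto_sandwich[of "\<lambda>_. 0" _ _ "\<lambda>n. 1 / real n"])
    have "real (n mod m) / (real m * real n) \<le> real m / (real m * real n)" for n
      using assms by (intro divide_right_mono) (auto simp: less_imp_le)
    then show "eventually (\<lambda>n. real (n mod m) / (real m * real n) \<le> 1 / real n) sequentially"
      using assms by simp
  qed (auto intro: lim_1_over_n)
  then have "(\<lambda>n. 1 / real m - real (n mod m) / (real m * real n)) \<longlonglongrightarrow> 1 / real m - 0"
    by (intro tendsto_intros)
  moreover have "real (n div m) / real n = 1 / real m - real (n mod m) / (real m * real n)" if "n \<ge> 1" for n
  proof -
    have "real (n - n mod m) = real m * real (n div m)"
      by (simp add: minus_mod_eq_mult_div)
    then have "real n - real (n mod m) = real m * real (n div m)"
      by (simp add: of_nat_diff)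
    moreover have "1 / real m - real (n mod m) / (real m * real n) = (real n - real (n mod m)) / (real m * real n)"
      using assms that by (simp add: field_simps)
    ultimately show ?thesis
      using assms by simp
  qed
  ultimately show ?thesis
    by (simp add: Lim_transform_eventually[OF _ eventually_sequentiallyI[of 1]])
qed

lemma filterlim_div_sequentially:
  assumes "m \<ge> 1"
  shows "filterlim (\<lambda>n. n div m) at_top sequentially"
  unfolding filterlim_at_top
proof
  fix Z :: nat
  have "Z \<le> n div m" if "n \<ge> Z * m" for n
    using div_le_mono[OF that, of m] assms by simp
  then show "eventually (\<lambda>n. Z \<le> n div m) sequentially"
    by (auto intro: eventually_sequentiallyI)
qed

text \<open>a n k stands for the value of an almost additive quantity on the window of length n starting
  at position k.\<close>

context
  fixes a :: "nat \<Rightarrow> nat \<Rightarrow> real" and \<kappa> B :: real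
  assumes sub: "\<And>n n' k. a (n + n') k \<le> a n k + a n' (k + n)"
    and sup: "\<And>n n' k. a n k + a n' (k + n) - \<kappa> \<le> a (n + n') k"
    and bounds: "\<And>n k. 0 \<le> a n k \<and> a n k \<le> real n * B"
begin

lemma window_block_sum_bounds:
  "(\<Sum>j<q. a m (j*m)) - real (q + 1) * \<kappa> \<le> a (q*m + r) 0 \<and>
   a (q*m + r) 0 \<le> (\<Sum>j<q. a m (j*m)) + real r * B"
proof -
  have "a (q*m) 0 \<le> (\<Sum>j<q. a m (j*m)) \<and> (\<Sum>j<q. a m (j*m)) - real q * \<kappa> \<le> a (q*m) 0"
  proof (induction q)
    case 0
    then show ?case
      using bounds[of 0 0] by simp
  next
    case (Suc q)
    then show ?case
      using sub[of "q*m" m 0] sup[of "q*m" 0 m] by (simp add: add.commute algebra_simps)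
  qed
  then show ?thesis
    using sub[of "q*m" r 0] sup[of "q*m" 0 r] bounds[of r "q*m"] by (simp add: algebra_simps)
qed

lemma eventually_window_average_bounds:
  assumes m: "m \<ge> 1" and \<delta>: "\<delta> > 0"
    and lim: "(\<lambda>q. (\<Sum>j<q. a m (j*m)) / q) \<longlonglongrightarrow> e"
  shows "eventually (\<lambda>n. (e - \<kappa>) / m - \<delta> < a n 0 / n \<and> a n 0 / n < e / m + \<delta>) sequentially"
proof -
  define S where "S q = (\<Sum>j<q. a m (j*m))" for q
  have B: "B \<ge> 0"
    using bounds[of 1 0] by simp
  have "(\<lambda>n. S (n div m) / (n div m) * (real (n div m) / n)) \<longlonglongrightarrow> e * (1 / m)"
    using filterlim_compose[OF lim filterlim_div_sequentially[OF m]] tendsto_real_div_over_n[OF m]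
    by (intro tendsto_mult) (simp_all add: S_def)
  moreover have "S q / q * (q / n) = S q / n" for q n
    by (cases "q = 0") (simp_all add: S_def)
  ultimately have S_lim: "(\<lambda>n. S (n div m) / n) \<longlonglongrightarrow> e / m"
    by (simp only:) simp
  have "(\<lambda>n. S (n div m) / n - \<kappa> * (real (n div m) / n) - \<kappa> / n) \<longlonglongrightarrow> e / m - \<kappa> * (1 / m) - 0"
    by (intro tendsto_intros S_lim tendsto_real_div_over_n[OF m])
  then have "eventually (\<lambda>n. (e - \<kappa>) / m - \<delta> < S (n div m) / n - \<kappa> * (real (n div m) / n) - \<kappa> / n) sequentially"
    using \<delta> by (intro order_tendstoD) (auto simp: diff_divide_distrib)
  moreover have "(\<lambda>n. S (n div m) / n + real m * B / n) \<longlonglongrightarrow> e / m + 0"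
    by (intro tendsto_intros S_lim)
  then have "eventually (\<lambda>n. S (n div m) / n + real m * B / n < e / m + \<delta>) sequentially"
    using \<delta> by (intro order_tendstoD) auto
  ultimately show ?thesis
  proof eventually_elim
    case (elim n)
    have n: "n = (n div m) * m + n mod m"
      by simp
    have "S (n div m) - real (n div m + 1) * \<kappa> \<le> a n 0" "a n 0 \<le> S (n div m) + real (n mod m) * B"
      using window_block_sum_bounds[where q = "n div m" and m = m and r = "n mod m"] by (simp_all add: S_def flip: n)
    moreover have "real (n mod m) * B \<le> real m * B"
      using m B by (intro mult_right_mono) (auto simp: less_imp_le)
    ultimately have "(S (n div m) - real (n div m + 1) * \<kappa>) / n \<le> a n 0 / n"
        "a n 0 / n \<le> (S (n div m) + real m * B) / n"
      by (simp_all add: divide_right_mono)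
    then show ?case
      using elim by (simp add: add_divide_distrib diff_divide_distrib algebra_simps)
  qed
qed

lemma window_average_tendsto:
  assumes lim: "\<And>m. m \<ge> 1 \<Longrightarrow> (\<lambda>q. (\<Sum>j<q. a m (j*m)) / q) \<longlonglongrightarrow> E m"
    and slope: "\<And>m. m \<ge> 1 \<Longrightarrow> \<gamma> \<le> E m / m \<and> (E m - \<kappa>) / m \<le> \<gamma>"
  shows "(\<lambda>n. a n 0 / n) \<longlonglongrightarrow> \<gamma>"
  unfolding tendsto_iff dist_real_def
proof (intro allI impI)
  fix \<epsilon> :: real
  assume \<epsilon>: "\<epsilon> > 0"
  define m where "m = nat \<lceil>2 * \<kappa> / \<epsilon>\<rceil> + 1"
  have m: "m \<ge> 1"
    by (simp add: m_def)
  have "2 * \<kappa> / \<epsilon> < m"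
    unfolding m_def by linarith
  then have \<kappa>: "\<kappa> / m < \<epsilon> / 2"
    using \<epsilon> m by (simp add: field_simps)
  have "E m / m - \<kappa> / m \<le> \<gamma>" "\<gamma> \<le> E m / m"
    using slope[OF m] by (simp_all add: diff_divide_distrib)
  moreover have "eventually (\<lambda>n. (E m - \<kappa>) / m - \<epsilon> / 2 < a n 0 / n \<and> a n 0 / n < E m / m + \<epsilon> / 2)
      sequentially"
    using \<epsilon> by (intro eventually_window_average_bounds m lim) simp
  ultimately show "eventually (\<lambda>n. \<bar>a n 0 / n - \<gamma>\<bar> < \<epsilon>) sequentially"
    using \<kappa> by (elim eventually_mono) (auto simp: diff_divide_distrib abs_less_iff)
qed

end

section \<open>Almost additive functionals of i.i.d. words\<close>

lemma (in prob_space) AE_tendsto_if_summable_deviations: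
  fixes Y :: "nat \<Rightarrow> 'a \<Rightarrow> real"
  assumes [measurable]: "\<And>q. Y q \<in> borel_measurable M"
    and summable: "\<And>\<epsilon>. \<epsilon> > 0 \<Longrightarrow> summable (\<lambda>q. prob {x\<in>space M. \<epsilon> \<le> \<bar>Y q x - \<mu>\<bar>})"
  shows "AE x in M. (\<lambda>q. Y q x) \<longlonglongrightarrow> \<mu>"
proof -
  have "AE x in M. eventually (\<lambda>q. \<bar>Y q x - \<mu>\<bar> < \<epsilon>) sequentially" if "\<epsilon> > 0" for \<epsilon>
  proof -
    have "AE x in M. eventually (\<lambda>q. x \<in> space M - {x\<in>space M. \<epsilon> \<le> \<bar>Y q x - \<mu>\<bar>}) sequentially"
      using summable[OF that] by (intro borel_cantelli_AE1) (auto simp: emeasure_eq_measure)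
    then show ?thesis
      by (rule eventually_mono) (auto elim: eventually_mono)
  qed
  then have "AE x in M. \<forall>k. eventually (\<lambda>q. \<bar>Y q x - \<mu>\<bar> < inverse (Suc k)) sequentially"
    by (subst AE_all_countable) simp
  then show ?thesis
  proof (rule eventually_mono)
    fix x
    assume ev: "\<forall>k. eventually (\<lambda>q. \<bar>Y q x - \<mu>\<bar> < inverse (Suc k)) sequentially"
    show "(\<lambda>q. Y q x) \<longlonglongrightarrow> \<mu>"
      unfolding tendsto_iff dist_real_def
    proof (intro allI impI)
      fix r :: real
      assume "r > 0"
      then obtain k where k: "inverse (Suc k) < r"
        using reals_Archimedean by blast
      show "eventually (\<lambda>q. \<bar>Y q x - \<mu>\<bar> < r) sequentially"
        using ev[THEN spec, of k] by eventually_elim (use k in simp)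
    qed
  qed
qed

lemma snth_to_stream: "to_stream X !! i = X i"
proof -
  have "nats !! i = i"
    by (induction i) (simp_all add: snth_siterate)
  then show ?thesis
    by (simp add: to_stream_def)
qed

lemma stake_sdrop_eq_map: "stake n (sdrop k w) = map (\<lambda>i. w !! i) [k..<k+n]"
  by (rule nth_equalityI) (auto simp: sdrop_snth)

locale iid_stream =
  fixes p :: "'i::countable pmf"
begin

definition S where "S = stream_space (measure_pmf p)"

sublocale S: prob_space S
  unfolding S_def by (rule prob_space.prob_space_stream_space[OF prob_space_measure_pmf])

lemma space_S [simp]: "space S = UNIV"
  by (simp add: S_def space_stream_space)

lemma measurable_stake_S: "stake n \<in> measurable S (count_space UNIV)"
proof -
  have "sets S = sets (stream_space (count_space UNIV))"
    unfolding S_def by (rule sets_stream_space_cong) simp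
  then show ?thesis
    by (subst measurable_cong_sets[OF _ refl]) (auto intro: measurable_stake)
qed

lemma measurable_sdrop_S [measurable]: "sdrop n \<in> measurable S S"
  unfolding S_def by (rule measurable_sdrop)

lemma borel_measurable_stake [measurable]:
  "(\<lambda>\<omega>. g (stake n \<omega>)) \<in> borel_measurable S" for g :: "'i list \<Rightarrow> real"
  by (rule measurable_compose[OF measurable_stake_S]) simp

lemma borel_measurable_stake_sdrop [measurable]:
  "(\<lambda>\<omega>. g (stake n (sdrop k \<omega>))) \<in> borel_measurable S" for g :: "'i list \<Rightarrow> real"
  by (rule measurable_compose[OF measurable_sdrop_S borel_measurable_stake])

lemma distr_stl: "distr S S stl = S"
proof (rule measure_eqI)
  fix X
  assume X: "X \<in> sets (distr S S stl)"
  have stl: "stl \<in> measurable S S"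
    unfolding S_def by (rule measurable_stl)
  have "emeasure (distr S S stl) X = emeasure S (stl -` X \<inter> space S)"
    using X stl by (simp add: emeasure_distr)
  also have "\<dots> = (\<integral>\<^sup>+t. emeasure S {x\<in>space S. t ## x \<in> stl -` X \<inter> space S} \<partial>measure_pmf p)"
    unfolding S_def
    by (rule prob_space.emeasure_stream_space[OF prob_space_measure_pmf])
      (use X measurable_sets[OF stl, of X] in \<open>simp add: S_def[symmetric]\<close>)
  also have "\<dots> = (\<integral>\<^sup>+t. emeasure S X \<partial>measure_pmf p)"
    by simp
  also have "\<dots> = emeasure S X"
    by (simp add: measure_pmf.emeasure_space_1)
  finally show "emeasure (distr S S stl) X = emeasure S X" .
qed simp

lemma distr_sdrop: "distr S S (sdrop n) = S"
proof (induction n)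
  case (Suc n)
  have stl: "stl \<in> measurable S S"
    unfolding S_def by (rule measurable_stl)
  have "sdrop (Suc n) = sdrop n \<circ> stl"
    by (rule ext) simp
  then have "distr S S (sdrop (Suc n)) = distr S S (sdrop n \<circ> stl)"
    by (rule arg_cong)
  also have "\<dots> = distr (distr S S stl) S (sdrop n)"
    by (rule distr_distr[symmetric]) (simp_all add: stl)
  finally show ?case
    using Suc distr_stl by (simp only:)
qed simp

lemma distr_stake_sdrop:
  "distr S borel (\<lambda>\<omega>. g (stake m (sdrop n \<omega>))) = distr S borel (\<lambda>\<omega>. g (stake m \<omega>))"
  for g :: "'i list \<Rightarrow> real"
proof -
  have "distr S borel (\<lambda>\<omega>. g (stake m (sdrop n \<omega>))) = distr (distr S S (sdrop n)) borel (\<lambda>\<omega>. g (stake m \<omega>))"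
    by (simp add: distr_distr comp_def)
  then show ?thesis
    by (simp add: distr_sdrop)
qed

lemma integral_stake_sdrop:
  "S.expectation (\<lambda>\<omega>. g (stake m (sdrop n \<omega>))) = S.expectation (\<lambda>\<omega>. g (stake m \<omega>))"
  for g :: "'i list \<Rightarrow> real"
  using integral_distr[OF measurable_sdrop_S[of n] borel_measurable_stake[of g m]]
  by (simp add: distr_sdrop)

lemma indep_snth: "S.indep_vars (\<lambda>_. measure_pmf p) (\<lambda>i \<omega>. \<omega> !! i) UNIV"
proof -
  interpret product_prob_space "\<lambda>_. measure_pmf p" UNIV ..
  let ?P = "\<Pi>\<^sub>M i\<in>UNIV. measure_pmf p"
  have S_eq: "S = distr ?P S to_stream"
    unfolding S_def by (rule stream_space_eq_distr)
  have to_stream: "to_stream \<in> measurable ?P S"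
    unfolding S_def by simp
  have coords: "(\<lambda>x. \<lambda>i\<in>UNIV. x !! i) \<in> measurable S ?P"
    unfolding S_def using measurable_snth_PiM by simp
  have snth: "(\<lambda>\<omega>. \<omega> !! i) \<in> measurable S (measure_pmf p)" for i
    unfolding S_def by (rule measurable_snth)
  have "distr S ?P (\<lambda>x. \<lambda>i\<in>UNIV. x !! i) = distr ?P ?P ((\<lambda>x. \<lambda>i\<in>UNIV. x !! i) \<circ> to_stream)"
    by (subst S_eq, rule distr_distr[OF coords to_stream])
  also have "(\<lambda>x. \<lambda>i\<in>UNIV. x !! i) \<circ> to_stream = (\<lambda>x. x)"
    by (rule ext) (simp add: snth_to_stream restrict_def fun_eq_iff)
  finally have joint: "distr S ?P (\<lambda>x. \<lambda>i\<in>UNIV. x !! i) = ?P"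
    by (simp only: distr_id)
  have marginal: "distr S (measure_pmf p) (\<lambda>\<omega>. \<omega> !! i) = measure_pmf p" for i
  proof -
    have "distr S (measure_pmf p) (\<lambda>\<omega>. \<omega> !! i) = distr ?P (measure_pmf p) ((\<lambda>\<omega>. \<omega> !! i) \<circ> to_stream)"
      by (subst S_eq, rule distr_distr[OF snth to_stream])
    also have "(\<lambda>\<omega>. \<omega> !! i) \<circ> to_stream = (\<lambda>X. X i)"
      by (rule ext) (simp add: snth_to_stream)
    also have "distr ?P (measure_pmf p) (\<lambda>X. X i) = measure_pmf p"
      by (rule PiM_component) simp
    finally show ?thesis .
  qed
  show ?thesis
  proof (subst S.indep_vars_iff_distr_eq_PiM)
    show "distr S ?P (\<lambda>x. \<lambda>i\<in>UNIV. x !! i) = (\<Pi>\<^sub>M i\<in>UNIV. distr S (measure_pmf p) (\<lambda>\<omega>. \<omega> !! i))"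
      unfolding marginal joint ..
    show "(\<lambda>\<omega>. \<omega> !! i) \<in> measurable S (measure_pmf p)" for i
      by (rule snth)
  qed simp
qed

lemma indep_blocks:
  fixes g :: "'i list \<Rightarrow> real"
  assumes m: "m \<ge> 1"
  shows "S.indep_vars (\<lambda>_. borel) (\<lambda>j \<omega>. g (stake m (sdrop (j*m) \<omega>))) UNIV"
proof -
  define blk where "blk j = {j*m ..< j*m + m}" for j
  have "disjoint_family blk"
    unfolding disjoint_family_on_def
  proof (intro ballI impI)
    fix a b :: nat
    assume "a \<noteq> b"
    then have "Suc a \<le> b \<or> Suc b \<le> a"
      by linarith
    then have "Suc a * m \<le> b * m \<or> Suc b * m \<le> a * m"
      using mult_le_mono1 by blast
    then have "a * m + m \<le> b * m \<or> b * m + m \<le> a * m"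
      by (simp add: add.commute)
    then show "blk a \<inter> blk b = {}"
      by (auto simp: blk_def)
  qed
  then have I: "S.indep_vars (\<lambda>j. PiM (blk j) (\<lambda>_. measure_pmf p)) (\<lambda>j \<omega>. restrict (\<lambda>i. \<omega> !! i) (blk j)) UNIV"
    by (intro S.indep_vars_restrict[OF indep_snth]) auto
  define Y where "Y j h = g (map h [j*m..<j*m+m])" for j and h :: "nat \<Rightarrow> 'i"
  have "Y j \<in> borel_measurable (PiM (blk j) (\<lambda>_. measure_pmf p))" for j
  proof -
    have "sets (PiM (blk j) (\<lambda>_. measure_pmf p)) = sets (PiM (blk j) (\<lambda>_. count_space (UNIV :: 'i set)))"
      by (rule sets_PiM_cong) simp_all
    also have "\<dots> = sets (count_space (PiE (blk j) (\<lambda>_. UNIV)))"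
      by (subst count_space_PiM_finite) (simp_all add: blk_def)
    finally have e: "sets (PiM (blk j) (\<lambda>_. measure_pmf p)) = sets (count_space (PiE (blk j) (\<lambda>_. UNIV :: 'i set)))" .
    show ?thesis
      by (subst measurable_cong_sets[OF e refl]) simp
  qed
  with I have "S.indep_vars (\<lambda>_. borel) (\<lambda>j \<omega>. Y j (restrict (\<lambda>i. \<omega> !! i) (blk j))) UNIV"
    by (rule S.indep_vars_compose2)
  moreover have "Y j (restrict (\<lambda>i. \<omega> !! i) (blk j)) = g (stake m (sdrop (j*m) \<omega>))" for j \<omega>
    unfolding Y_def stake_sdrop_eq_map by (intro arg_cong[where f = g] map_cong) (auto simp: blk_def)
  ultimately show ?thesis
    by simp
qed

end

context iid_stream
begin

lemma block_average_deviation_le: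
  fixes g :: "'i list \<Rightarrow> real"
  assumes m: "m \<ge> 1" and bounded: "\<And>xs. length xs = m \<Longrightarrow> 0 \<le> g xs \<and> g xs \<le> C"
    and q: "q \<ge> 1" and \<epsilon>: "\<epsilon> \<ge> 0"
  shows "S.prob {\<omega>\<in>space S. \<epsilon> \<le> \<bar>(\<Sum>j<q. g (stake m (sdrop (j*m) \<omega>))) / q - S.expectation (\<lambda>\<omega>. g (stake m \<omega>))\<bar>}
    \<le> 2 * exp (- 2 * real q * \<epsilon>\<^sup>2 / (C + 1)\<^sup>2)"
proof -
  define X where "X j \<omega> = g (stake m (sdrop (j*m) \<omega>))" for j \<omega>
  have C: "C \<ge> 0"
    using bounded[of "replicate m undefined"] by simp
  interpret Hoeffding_ineq_iid S "{..<q}" X "X 0" 0 "C + 1" "S.expectation (\<lambda>\<omega>. g (stake m \<omega>))"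
  proof unfold_locales
    show "X j \<in> borel_measurable S" for j
      unfolding X_def by (rule borel_measurable_stake_sdrop)
    show "S.indep_vars (\<lambda>_. borel) X {..<q}"
      using S.indep_vars_subset[OF indep_blocks[OF m, of g]] unfolding X_def by blast
    show "distr S borel (X i) = distr S borel (X 0)" for i
      unfolding X_def by (simp add: distr_stake_sdrop)
    show "AE x in S. X 0 x \<in> {0..C + 1}"
    proof (rule AE_I2)
      show "X 0 x \<in> {0..C + 1}" for x
        using bounded[of "stake m x"] by (simp add: X_def)
    qed
    have "X 0 = (\<lambda>\<omega>. g (stake m \<omega>))"
      by (rule ext) (simp add: X_def)
    then show "S.expectation (\<lambda>\<omega>. g (stake m \<omega>)) \<equiv> S.expectation (X 0)"
      by simp
  qed simp_all
  have "S.prob {\<omega>\<in>space S. \<epsilon> \<le> \<bar>(\<Sum>j\<in>{..<q}. X j \<omega>) / real (card {..<q}) - S.expectation (\<lambda>\<omega>. g (stake m \<omega>))\<bar>}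
      \<le> 2 * exp (- 2 * real (card {..<q}) * \<epsilon>\<^sup>2 / (C + 1 - 0)\<^sup>2)"
    by (rule Hoeffding_ineq_abs_ge') (use \<epsilon> C q in \<open>auto simp: lessThan_empty_iff\<close>)
  then show ?thesis
    by (simp only: X_def card_lessThan diff_zero)
qed

lemma AE_block_average_tendsto:
  fixes g :: "'i list \<Rightarrow> real"
  assumes m: "m \<ge> 1" and bounded: "\<And>xs. length xs = m \<Longrightarrow> 0 \<le> g xs \<and> g xs \<le> C"
  shows "AE \<omega> in S. (\<lambda>q. (\<Sum>j<q. g (stake m (sdrop (j*m) \<omega>))) / q) \<longlonglongrightarrow> S.expectation (\<lambda>\<omega>. g (stake m \<omega>))"
proof (rule S.AE_tendsto_if_summable_deviations)
  fix \<epsilon> :: real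
  assume \<epsilon>: "\<epsilon> > 0"
  define D where "D q = {\<omega>\<in>space S. \<epsilon> \<le> \<bar>(\<Sum>j<q. g (stake m (sdrop (j*m) \<omega>))) / q - S.expectation (\<lambda>\<omega>. g (stake m \<omega>))\<bar>}"
    for q
  define r where "r = exp (- 2 * \<epsilon>\<^sup>2 / (C + 1)\<^sup>2)"
  have "C \<ge> 0"
    using bounded[of "replicate m undefined"] by simp
  then have r: "0 \<le> r" "r < 1"
    using \<epsilon> by (auto simp: r_def)
  have tail: "S.prob (D q) \<le> 2 * r ^ q" for q
  proof (cases "q = 0")
    case False
    have "S.prob (D q) \<le> 2 * exp (- 2 * real q * \<epsilon>\<^sup>2 / (C + 1)\<^sup>2)"
      unfolding D_def by (rule block_average_deviation_le[OF m bounded]) (use False \<epsilon> in auto)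
    moreover have "- 2 * real q * \<epsilon>\<^sup>2 / (C + 1)\<^sup>2 = real q * (- 2 * \<epsilon>\<^sup>2 / (C + 1)\<^sup>2)"
      by simp
    ultimately show ?thesis
      by (simp only: r_def exp_of_nat_mult)
  qed (use order_trans[OF S.prob_le_1[of "D 0"]] in simp)
  have "summable (\<lambda>q. 2 * r ^ q)"
    using r by (intro summable_mult summable_geometric) auto
  then have "summable (\<lambda>q. S.prob (D q))"
    by (rule summable_comparison_test'[where N = 0]) (simp add: tail)
  then show "summable (\<lambda>q. S.prob {\<omega>\<in>space S. \<epsilon> \<le> \<bar>(\<Sum>j<q. g (stake m (sdrop (j*m) \<omega>))) / q
      - S.expectation (\<lambda>\<omega>. g (stake m \<omega>))\<bar>})"
    unfolding D_def .
qed simp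

context
  fixes f :: "'i list \<Rightarrow> real" and \<kappa> B :: real
  assumes sub: "\<And>xs ys. f (xs @ ys) \<le> f xs + f ys"
    and sup: "\<And>xs ys. f xs + f ys - \<kappa> \<le> f (xs @ ys)"
    and bounds: "\<And>xs. 0 \<le> f xs \<and> f xs \<le> real (length xs) * B"
begin

lemma integrable_stake_sdrop: "integrable S (\<lambda>\<omega>. f (stake n (sdrop k \<omega>)))"
proof (rule S.integrable_const_bound[where B = "real n * B"])
  show "AE \<omega> in S. norm (f (stake n (sdrop k \<omega>))) \<le> real n * B"
  proof (rule AE_I2)
    show "norm (f (stake n (sdrop k \<omega>))) \<le> real n * B" for \<omega>
      using bounds[of "stake n (sdrop k \<omega>)"] by simp
  qed
qed simp

lemma expectation_stake_almost_additive:
  defines "E \<equiv> \<lambda>n. S.expectation (\<lambda>\<omega>. f (stake n \<omega>))"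
  shows "E (n + m) \<le> E n + E m" "E n + E m - \<kappa> \<le> E (n + m)"
proof -
  have split: "stake (n + m) \<omega> = stake n \<omega> @ stake m (sdrop n \<omega>)" for \<omega>
    by (rule stake_add[symmetric])
  have "E n + E m = S.expectation (\<lambda>\<omega>. f (stake n \<omega>) + f (stake m (sdrop n \<omega>)))"
    using integrable_stake_sdrop[of n 0] integrable_stake_sdrop[of m n]
    by (simp add: E_def integral_stake_sdrop)
  moreover have "E (n + m) \<le> S.expectation (\<lambda>\<omega>. f (stake n \<omega>) + f (stake m (sdrop n \<omega>)))"
    unfolding E_def using integrable_stake_sdrop[of "n + m" 0] integrable_stake_sdrop[of n 0] integrable_stake_sdrop[of m n]
    by (intro integral_mono) (auto simp: split sub simp del: stake_add)
  moreover have "S.expectation (\<lambda>\<omega>. f (stake n \<omega>) + f (stake m (sdrop n \<omega>)) - \<kappa>) \<le> E (n + m)"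
    unfolding E_def using integrable_stake_sdrop[of "n + m" 0] integrable_stake_sdrop[of n 0] integrable_stake_sdrop[of m n]
    by (intro integral_mono) (auto simp: split sup simp del: stake_add)
  moreover have "S.expectation (\<lambda>\<omega>. f (stake n \<omega>) + f (stake m (sdrop n \<omega>)) - \<kappa>)
      = S.expectation (\<lambda>\<omega>. f (stake n \<omega>) + f (stake m (sdrop n \<omega>))) - \<kappa>"
    using integrable_stake_sdrop[of n 0] integrable_stake_sdrop[of m n] using S.prob_space by simp
  ultimately show "E (n + m) \<le> E n + E m" "E n + E m - \<kappa> \<le> E (n + m)"
    by linarith+
qed

lemma expectation_stake_slope:
  "\<exists>\<gamma>. \<forall>m\<ge>1. \<gamma> \<le> S.expectation (\<lambda>\<omega>. f (stake m \<omega>)) / m \<and>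
     (S.expectation (\<lambda>\<omega>. f (stake m \<omega>)) - \<kappa>) / m \<le> \<gamma>"
proof (rule almost_additive_slope_bounds)
  show "S.expectation (\<lambda>\<omega>. f (stake (n + m) \<omega>))
      \<le> S.expectation (\<lambda>\<omega>. f (stake n \<omega>)) + S.expectation (\<lambda>\<omega>. f (stake m \<omega>))"
    and "S.expectation (\<lambda>\<omega>. f (stake n \<omega>)) + S.expectation (\<lambda>\<omega>. f (stake m \<omega>)) - \<kappa>
      \<le> S.expectation (\<lambda>\<omega>. f (stake (n + m) \<omega>))" for n m
    by (rule expectation_stake_almost_additive)+
  show "0 \<le> S.expectation (\<lambda>\<omega>. f (stake n \<omega>))" for n
  proof (intro integral_nonneg_AE AE_I2)
    show "0 \<le> f (stake n \<omega>)" for \<omega>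
      using bounds[of "stake n \<omega>"] by simp
  qed
  show "S.expectation (\<lambda>\<omega>. f (stake 0 \<omega>)) = 0"
    using bounds[of "[]"] by simp
qed

lemma AE_all_block_averages_tendsto:
  "AE \<omega> in S. \<forall>m\<ge>1. (\<lambda>q. (\<Sum>j<q. f (stake m (sdrop (j*m) \<omega>))) / q)
     \<longlonglongrightarrow> S.expectation (\<lambda>\<omega>. f (stake m \<omega>))"
  unfolding AE_all_countable
proof (intro allI)
  fix m :: nat
  show "AE \<omega> in S. m \<ge> 1 \<longrightarrow> (\<lambda>q. (\<Sum>j<q. f (stake m (sdrop (j*m) \<omega>))) / q)
      \<longlonglongrightarrow> S.expectation (\<lambda>\<omega>. f (stake m \<omega>))"
  proof (cases "m \<ge> 1")
    case True
    have "AE \<omega> in S. (\<lambda>q. (\<Sum>j<q. f (stake m (sdrop (j*m) \<omega>))) / q) \<longlonglongrightarrow> S.expectation (\<lambda>\<omega>. f (stake m \<omega>))"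
    proof (rule AE_block_average_tendsto[OF True, where C = "real m * B"])
      show "0 \<le> f xs \<and> f xs \<le> real m * B" if "length xs = m" for xs
        using bounds[of xs] that by simp
    qed
    then show ?thesis
      by simp
  qed simp
qed

text \<open>Since the additivity defect is bounded by \<kappa>, the block averages of length m determine the
  limit up to \<kappa> / m, so no subadditive ergodic theorem is needed.\<close>

theorem AE_almost_additive_tendsto: "\<exists>\<gamma>. AE \<omega> in S. (\<lambda>n. f (stake n \<omega>) / n) \<longlonglongrightarrow> \<gamma>"
proof -
  define E where "E m = S.expectation (\<lambda>\<omega>. f (stake m \<omega>))" for m
  obtain \<gamma> where slope: "\<And>m. m \<ge> 1 \<Longrightarrow> \<gamma> \<le> E m / m \<and> (E m - \<kappa>) / m \<le> \<gamma>"
    unfolding E_def using expectation_stake_slope by blast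
  have "AE \<omega> in S. (\<lambda>n. f (stake n (sdrop 0 \<omega>)) / n) \<longlonglongrightarrow> \<gamma>"
    using AE_all_block_averages_tendsto
  proof (rule eventually_mono)
    fix \<omega>
    assume lim: "\<forall>m\<ge>1. (\<lambda>q. (\<Sum>j<q. f (stake m (sdrop (j*m) \<omega>))) / q) \<longlonglongrightarrow> S.expectation (\<lambda>\<omega>. f (stake m \<omega>))"
    define a where "a n k = f (stake n (sdrop k \<omega>))" for n k
    have split: "stake (n + n') (sdrop k \<omega>) = stake n (sdrop k \<omega>) @ stake n' (sdrop (k + n) \<omega>)" for n n' k
      using stake_add[of n "sdrop k \<omega>" n'] by (simp only: sdrop_add)
    have "(\<lambda>n. a n 0 / n) \<longlonglongrightarrow> \<gamma>"
    proof (rule window_average_tendsto[where a = a and \<kappa> = \<kappa> and B = B and E = E])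
      show "a (n + n') k \<le> a n k + a n' (k + n)" "a n k + a n' (k + n) - \<kappa> \<le> a (n + n') k" for n n' k
        unfolding a_def split by (rule sub, rule sup)
      show "0 \<le> a n k \<and> a n k \<le> real n * B" for n k
        unfolding a_def using bounds[of "stake n (sdrop k \<omega>)"] by (simp only: length_stake)
      show "(\<lambda>q. (\<Sum>j<q. a m (j * m)) / q) \<longlonglongrightarrow> E m" if "m \<ge> 1" for m
        using lim that by (simp add: a_def E_def)
    qed (rule slope)
    then show "(\<lambda>n. f (stake n (sdrop 0 \<omega>)) / n) \<longlonglongrightarrow> \<gamma>"
      by (simp add: a_def)
  qed
  then show ?thesis
    by (intro exI[of _ \<gamma>]) simp
qed

end

end

section \<open>Lyapunov exponents\<close>

lemma onorm_mat_word_le_power: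
  assumes "\<And>i. onorm ((*v) (A i)) \<le> L"
  shows "onorm ((*v) (mat_word A w)) \<le> L ^ length w"
proof (induction w)
  case Nil
  then show ?case
    by (simp add: onorm_id_le)
next
  case (Cons i w)
  have "onorm ((*v) (mat_word A (i # w))) \<le> onorm ((*v) (A i)) * onorm ((*v) (mat_word A w))"
    by (simp add: onorm_matrix_mult_le)
  also have "\<dots> \<le> L * L ^ length w"
    using assms[of i] Cons onorm_matrix_nonneg by (intro mult_mono) (auto intro: order_trans)
  finally show ?case
    by simp
qed

lemma rp_deriv_phi_word:
  assumes "\<And>i. det (A i) = 1" "w \<noteq> []"
  shows "- ln \<bar>rp_deriv (phi_word A w) x\<bar> = 2 * ln (norm (mat_word A w *v dir_vec x))"
proof -
  have det: "det (mat_word A w) = 1"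
    using assms(1) by (rule det_mat_word)
  then have "norm (mat_word A w *v dir_vec x) > 0"
    using matrix_vector_mult_nonzero dir_vec_nonzero by simp
  then show ?thesis
    using phi_word_eq_phi_mat_word[OF assms] rp_deriv_phi[OF det]
    by (simp add: ln_div ln_realpow)
qed

context multicone_system
begin

lemma ln_onorm_mat_word_bounds:
  "0 \<le> ln (onorm ((*v) (mat_word A w)))"
  "ln (onorm ((*v) (mat_word A w))) \<le> real (length w) * ln (Max (range (\<lambda>i. onorm ((*v) (A i)))))"
proof -
  let ?L = "Max (range (\<lambda>i. onorm ((*v) (A i))))"
  have N: "1 \<le> onorm ((*v) (mat_word A w))"
    using onorm_ge_1 det_mat_word_A by blast
  then show "0 \<le> ln (onorm ((*v) (mat_word A w)))"
    by simp
  have "onorm ((*v) (mat_word A w)) \<le> ?L ^ length w"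
    by (rule onorm_mat_word_le_power) simp
  then show "ln (onorm ((*v) (mat_word A w))) \<le> real (length w) * ln ?L"
    using N by (simp add: ln_realpow[symmetric])
qed

lemma ln_onorm_mat_word_append_le:
  "ln (onorm ((*v) (mat_word A (xs @ ys)))) \<le> ln (onorm ((*v) (mat_word A xs))) + ln (onorm ((*v) (mat_word A ys)))"
proof -
  have pos: "0 < onorm ((*v) (mat_word A w))" for w
    using onorm_ge_1[OF det_mat_word_A, of w] by linarith
  have "onorm ((*v) (mat_word A (xs @ ys))) \<le> onorm ((*v) (mat_word A xs)) * onorm ((*v) (mat_word A ys))"
    unfolding mat_word_append by (rule onorm_matrix_mult_le)
  then have "ln (onorm ((*v) (mat_word A (xs @ ys))))
      \<le> ln (onorm ((*v) (mat_word A xs)) * onorm ((*v) (mat_word A ys)))"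
    using pos by (subst ln_le_cancel_iff) (auto intro: mult_pos_pos)
  then show ?thesis
    using pos[of xs] pos[of ys] by (simp add: ln_mult)
qed

context
  fixes c :: real
  assumes c: "c > 0"
    and comparison: "\<And>w v. v \<noteq> 0 \<Longrightarrow> proj_point v \<in> closure U \<Longrightarrow>
      c * onorm ((*v) (mat_word A w)) * norm v \<le> norm (mat_word A w *v v)"
begin

lemma onorm_mat_word_append_ge:
  "c\<^sup>2 * (onorm ((*v) (mat_word A xs)) * onorm ((*v) (mat_word A ys))) \<le> onorm ((*v) (mat_word A (xs @ ys)))"
proof -
  obtain v where v: "norm v = 1" "proj_point v \<in> U"
    using exists_unit_vec_in by blast
  then have "v \<noteq> 0"
    by auto
  define x where "x = mat_word A ys *v v"
  have "proj_point x \<in> U"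
    unfolding x_def using \<open>v \<noteq> 0\<close> v(2) by (rule proj_point_mat_word_in)
  then have x: "x \<noteq> 0" "proj_point x \<in> closure U"
    using matrix_vector_mult_nonzero det_mat_word_A \<open>v \<noteq> 0\<close> closure_subset[of U]
    by (auto simp: x_def)
  have "c * onorm ((*v) (mat_word A ys)) \<le> norm x"
    using comparison[OF \<open>v \<noteq> 0\<close>, of ys] v closure_subset by (auto simp: x_def)
  then have "c * onorm ((*v) (mat_word A xs)) * (c * onorm ((*v) (mat_word A ys)))
      \<le> c * onorm ((*v) (mat_word A xs)) * norm x"
    using mult_nonneg_nonneg[OF less_imp_le[OF c] onorm_matrix_nonneg] by (rule mult_left_mono)
  then have "c\<^sup>2 * (onorm ((*v) (mat_word A xs)) * onorm ((*v) (mat_word A ys)))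
      \<le> c * onorm ((*v) (mat_word A xs)) * norm x"
    by (simp add: power2_eq_square mult_ac)
  also have "\<dots> \<le> norm (mat_word A xs *v x)"
    by (rule comparison[OF x])
  also have "\<dots> \<le> onorm ((*v) (mat_word A (xs @ ys)))"
    using norm_matrix_vector_mult_le[of "mat_word A (xs @ ys)" v] v
    by (simp add: x_def mat_word_append matrix_vector_mul_assoc)
  finally show ?thesis .
qed

lemma ln_onorm_mat_word_append_ge:
  "ln (onorm ((*v) (mat_word A xs))) + ln (onorm ((*v) (mat_word A ys))) + 2 * ln c
    \<le> ln (onorm ((*v) (mat_word A (xs @ ys))))"
proof -
  have N: "1 \<le> onorm ((*v) (mat_word A w))" for w
    using onorm_ge_1 det_mat_word_A by blast
  have "ln (onorm ((*v) (mat_word A xs))) + ln (onorm ((*v) (mat_word A ys))) + 2 * ln c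
      = ln (c\<^sup>2 * (onorm ((*v) (mat_word A xs)) * onorm ((*v) (mat_word A ys))))"
    using c N[of xs] N[of ys] by (simp add: ln_mult ln_realpow)
  also have "\<dots> \<le> ln (onorm ((*v) (mat_word A (xs @ ys))))"
    using onorm_mat_word_append_ge c N[of xs] N[of ys] N[of "xs @ ys"] by (subst ln_le_cancel_iff) auto
  finally show ?thesis .
qed

lemma ln_norm_mat_word_bounds:
  assumes "rp_emb x \<in> U"
  shows "ln c + ln (onorm ((*v) (mat_word A w))) \<le> ln (norm (mat_word A w *v dir_vec x))"
    and "ln (norm (mat_word A w *v dir_vec x)) \<le> ln (onorm ((*v) (mat_word A w)))"
proof -
  let ?N = "onorm ((*v) (mat_word A w))" and ?v = "norm (mat_word A w *v dir_vec x)"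
  have N: "?N \<ge> 1"
    using onorm_ge_1 det_mat_word_A by blast
  have lower: "c * ?N \<le> ?v"
    using comparison[OF dir_vec_nonzero] assms closure_subset by (auto simp: proj_point_dir_vec norm_dir_vec)
  have upper: "?v \<le> ?N"
    using norm_matrix_vector_mult_le[of "mat_word A w" "dir_vec x"] by (simp add: norm_dir_vec)
  have pos: "0 < c * ?N"
    using c N by simp
  then have "0 < ?v"
    using lower by linarith
  then have "ln (c * ?N) \<le> ln ?v"
    using pos lower by simp
  moreover have "ln c + ln ?N = ln (c * ?N)"
    using c N by (simp add: ln_mult)
  ultimately show "ln c + ln ?N \<le> ln ?v"
    by linarith
  show "ln ?v \<le> ln ?N"
    using \<open>0 < ?v\<close> upper N by (subst ln_le_cancel_iff) auto
qed

lemma tendsto_ln_deriv_if_tendsto_ln_onorm: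
  assumes \<theta>: "rp_emb \<theta> \<in> U"
    and lim: "(\<lambda>n. ln (onorm ((*v) (mat_word A (stake n \<omega>)))) / n) \<longlonglongrightarrow> \<gamma>"
  shows "(\<lambda>n. - ln \<bar>rp_deriv (phi_word A (stake n \<omega>)) \<theta>\<bar> / n) \<longlonglongrightarrow> 2 * \<gamma>"
proof -
  define N where "N n = ln (onorm ((*v) (mat_word A (stake n \<omega>))))" for n
  define V where "V n = ln (norm (mat_word A (stake n \<omega>) *v dir_vec \<theta>))" for n
  have "(\<lambda>n. (V n - N n) / n) \<longlonglongrightarrow> 0"
  proof (rule tendsto_sandwich[where f = "\<lambda>n::nat. ln c / real n" and h = "\<lambda>_. 0"])
    have "ln c \<le> V n - N n" "V n - N n \<le> 0" for n
      using ln_norm_mat_word_bounds[OF \<theta>, where w = "stake n \<omega>"] by (simp_all add: N_def V_def)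
    then show "eventually (\<lambda>n. ln c / n \<le> (V n - N n) / n) sequentially"
      and "eventually (\<lambda>n. (V n - N n) / n \<le> 0) sequentially"
      by (auto intro!: always_eventually divide_right_mono divide_nonpos_nonneg)
  qed (simp_all add: lim_const_over_n)
  then have "(\<lambda>n. 2 * (N n / n) + 2 * ((V n - N n) / n)) \<longlonglongrightarrow> 2 * \<gamma> + 2 * 0"
    using lim unfolding N_def by (intro tendsto_intros)
  moreover have "2 * (N n / n) + 2 * ((V n - N n) / n) = - ln \<bar>rp_deriv (phi_word A (stake n \<omega>)) \<theta>\<bar> / n"
    if "n \<ge> 1" for n
    using rp_deriv_phi_word[OF det_A, where w = "stake n \<omega>" and x = \<theta>] that
    by (simp add: V_def diff_divide_distrib algebra_simps)
  ultimately show ?thesis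
    by (simp add: Lim_transform_eventually[OF _ eventually_sequentiallyI[of 1]])
qed

end

end

theorem lemma3p5:
  fixes A :: "'i::finite \<Rightarrow> real^2^2" and U :: "complex set" and p :: "'i pmf"
  assumes "\<And>i. det (A i) = 1"
    and "strictly_invariant_multicone A U"
    and "\<And>i. pmf p i > 0"
  shows "\<exists>\<chi>A. (AE \<omega> in stream_space (measure_pmf p).
              (\<lambda>n. ln (onorm ((*v) (mat_word A (stake n \<omega>)))) / real n) \<longlonglongrightarrow> \<chi>A)
          \<and> (\<forall>x0. rp_emb x0 \<in> U \<longrightarrow>
              (AE \<omega> in stream_space (measure_pmf p).
                (\<lambda>n. - ln \<bar>rp_deriv (phi_word A (stake n \<omega>)) x0\<bar> / real n) \<longlonglongrightarrow> 2 * \<chi>A))"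
proof -
  interpret multicone_system A U
    using assms(1,2) by unfold_locales
  interpret iid_stream p .
  obtain c where c: "c > 0" and comparison: "\<And>w v. v \<noteq> 0 \<Longrightarrow> proj_point v \<in> closure U \<Longrightarrow>
      c * onorm ((*v) (mat_word A w)) * norm v \<le> norm (mat_word A w *v v)"
    using cone_norm_comparison by blast
  have "\<exists>\<gamma>. AE \<omega> in S. (\<lambda>n. ln (onorm ((*v) (mat_word A (stake n \<omega>)))) / n) \<longlonglongrightarrow> \<gamma>"
  proof (rule AE_almost_additive_tendsto[where \<kappa> = "- 2 * ln c"])
    show "ln (onorm ((*v) (mat_word A xs))) + ln (onorm ((*v) (mat_word A ys))) - - 2 * ln c
        \<le> ln (onorm ((*v) (mat_word A (xs @ ys))))" for xs ys
      using ln_onorm_mat_word_append_ge[OF c comparison] by simp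
  qed (use ln_onorm_mat_word_append_le ln_onorm_mat_word_bounds in auto)
  then obtain \<gamma> where \<gamma>: "AE \<omega> in S. (\<lambda>n. ln (onorm ((*v) (mat_word A (stake n \<omega>)))) / n) \<longlonglongrightarrow> \<gamma>"
    by blast
  have "AE \<omega> in S. (\<lambda>n. - ln \<bar>rp_deriv (phi_word A (stake n \<omega>)) x0\<bar> / n) \<longlonglongrightarrow> 2 * \<gamma>"
    if "rp_emb x0 \<in> U" for x0
    using \<gamma> by (rule eventually_mono) (rule tendsto_ln_deriv_if_tendsto_ln_onorm[OF c comparison that])
  with \<gamma> show ?thesis
    unfolding S_def by blast
qed

end
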